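(* Let $I=(0,1)$ and let $\tilde u,H\in L^\infty(I)$ be real-valued with $\inf_IH>0$. Let $A_0:L^2(I)^2\to L^2(I)^2$ be the bounded operator $$A_0\begin{pmatrix}\phi_1\\ \phi_2\end{pmatrix}=\begin{pmatrix}\tilde u\,\phi_1+H\phi_2\\ g\int_0^1\phi_1\,\mathrm{d}\lambda+\tilde u\,\phi_2\end{pmatrix}.$$ Then $$\sigma(A_0)=\tilde u[I]\cup\left\{c\in\mathbb{C}\setminus\tilde u[I]:\int_0^1\frac{gH}{(c-\tilde u)^2}\,\mathrm{d}\lambda=1\right\},$$ with the following characterization: $$\sigma_p(A_0)=\left\{c\in\mathbb{C}:(c-\tilde u)^{-1}\in L^4(I)\text{ and }\int_0^1\frac{gH}{(c-\tilde u)^2}\,\mathrm{d}\lambda=1\right\}\cup\left\{c\in\tilde u[I]:\mathrm{meas}\bigl(\tilde u^{-1}(c)\bigr)>0\right\},$$ $$\sigma_c(A_0)=\tilde u[I]\setminus\sigma_p(A_0),\qquad \sigma_r(A_0)=\emptyset.$$ In particular, if $\tilde u\in C^{0,1/4}(\bar I)$, then the essential range $\tilde u[I]$ coincides with the image $\tilde u(\bar I)$, and for $c\in\tilde u(\bar I)$ one has $(c-\tilde u)^{-1}\notin L^4(I)$, so $$\sigma_p(A_0)=\left\{c\in\mathbb{C}\setminus\tilde u(\bar I):\int_0^1\frac{gH}{(c-\tilde u)^2}\,\mathrm{d}\lambda=1\right\}\cup\left\{c\in\tilde u(\bar I):\mathrm{meas}\bigl(\tilde u^{-1}(c)\bigr)>0\right\},$$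 $$\sigma_c(A_0)=\left\{c\in\tilde u(\bar I):\mathrm{meas}\bigl(\tilde u^{-1}(c)\bigr)=0\right\},\qquad \sigma_r(A_0)=\emptyset.$$
   Context: $g>0$ is a constant; $L^2(I)$ is the space of complex-valued square integrable functions; $\mathrm{meas}$ is Lebesgue measure and $\tilde u^{-1}(c)=\{\lambda\in I:\tilde u(\lambda)=c\}$; $\inf_I$ is the essential infimum. $C^{0,\alpha}(\bar I)$ is the space of Hölder continuous functions of index $\alpha$ on $\bar I=[0,1]$. For a bounded operator $A$ and $\mathbf{I}$ the identity: $\sigma(A)$ is the set of $c\in\mathbb{C}$ such that $A-c\mathbf{I}$ is not invertible; the point spectrum $\sigma_p(A)$ is the set of $c$ such that $A-c\mathbf{I}$ is not injective; the continuous spectrum $\sigma_c(A)$ is the set of $c$ such that $A-c\mathbf{I}$ is injective with range dense but not equal to the whole space; the residual spectrum $\sigma_r(A)$ is the set of $c$ such that $A-c\mathbf{I}$ is injective and its range is not dense. The essential range $\tilde u[I]$ is the set of $c\in\mathbb{R}$ such that for all $\varepsilon>0$ the set $\{\lambda\in I:|\tilde u(\lambda)-c|<\varepsilon\}$ has non-zero measure (for $c\in\mathbb{C}$, $c\in\tilde u[I]$ if and only if $(\tilde u-c)^{-1}\notin L^\infty(I)$). *)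

theory Defs
  imports "HOL-Analysis.Analysis" "HOL-Probability.Essential_Supremum"
begin

abbreviation I01 :: "real set" where
  "I01 \<equiv> {0<..<1}"

abbreviation MI :: "real measure" where
  "MI \<equiv> lebesgue_on I01"

definition in_Lp :: "nat \<Rightarrow> 'a measure \<Rightarrow> ('a \<Rightarrow> 'b::{real_normed_vector, second_countable_topology}) \<Rightarrow> bool" where
  "in_Lp p M f \<longleftrightarrow> f \<in> borel_measurable M \<and> integrable M (\<lambda>x. norm (f x) ^ p)"

definition in_Linf :: "'a measure \<Rightarrow> ('a \<Rightarrow> 'b::{real_normed_vector, second_countable_topology}) \<Rightarrow> bool" where
  "in_Linf M f \<longleftrightarrow> f \<in> borel_measurable M \<and> (\<exists>C. AE x in M. norm (f x) \<le> C)"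

definition essinf :: "'a measure \<Rightarrow> ('a \<Rightarrow> real) \<Rightarrow> ereal" where
  "essinf M f = - esssup M (\<lambda>x. - ereal (f x))"

text \<open>The statement \<open>f\<^sup>-\<^sup>1 \<in> L\<^sup>p\<close> includes that \<open>f\<close> is nonzero almost everywhere. This must
  be said explicitly, because \<open>inverse 0 = 0\<close> in HOL.\<close>

definition inverse_in_Lp :: "nat \<Rightarrow> 'a measure \<Rightarrow> ('a \<Rightarrow> complex) \<Rightarrow> bool" where
  "inverse_in_Lp p M f \<longleftrightarrow> (AE x in M. f x \<noteq> 0) \<and> in_Lp p M (\<lambda>x. inverse (f x))"

definition ess_range :: "(real \<Rightarrow> real) \<Rightarrow> real set" where
  "ess_range u = {c. \<forall>\<epsilon>>0. emeasure MI {x\<in>I01. \<bar>u x - c\<bar> < \<epsilon>} \<noteq> 0}"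

definition holder_on :: "real \<Rightarrow> real set \<Rightarrow> (real \<Rightarrow> real) \<Rightarrow> bool" where
  "holder_on \<alpha> S f \<longleftrightarrow> (\<exists>C. \<forall>x\<in>S. \<forall>y\<in>S. \<bar>f x - f y\<bar> \<le> C * \<bar>x - y\<bar> powr \<alpha>)"

class complex_normed_vector = real_normed_vector +
  fixes scaleC :: "complex \<Rightarrow> 'a \<Rightarrow> 'a"
  assumes scaleC_add_right: "scaleC a (x + y) = scaleC a x + scaleC a y"
    and scaleC_add_left: "scaleC (a + b) x = scaleC a x + scaleC b x"
    and scaleC_scaleC: "scaleC a (scaleC b x) = scaleC (a * b) x"
    and scaleC_one: "scaleC 1 x = x"
    and scaleR_eq_scaleC: "scaleR r x = scaleC (complex_of_real r) x"
    and norm_scaleC: "norm (scaleC a x) = cmod a * norm x"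

instantiation prod :: (complex_normed_vector, complex_normed_vector) complex_normed_vector
begin

definition scaleC_prod :: "complex \<Rightarrow> 'a \<times> 'b \<Rightarrow> 'a \<times> 'b" where
  "scaleC_prod c x = (scaleC c (fst x), scaleC c (snd x))"

instance
proof
  fix a b :: complex and r :: real and x y :: "'a \<times> 'b"
  show "scaleC a (x + y) = scaleC a x + scaleC a y"
    by (simp add: scaleC_prod_def scaleC_add_right)
  show "scaleC (a + b) x = scaleC a x + scaleC b x"
    by (simp add: scaleC_prod_def scaleC_add_left)
  show "scaleC a (scaleC b x) = scaleC (a * b) x"
    by (simp add: scaleC_prod_def scaleC_scaleC)
  show "scaleC 1 x = x"
    by (simp add: scaleC_prod_def scaleC_one)
  show "scaleR r x = scaleC (complex_of_real r) x"
    by (simp add: scaleC_prod_def scaleR_prod_def scaleR_eq_scaleC)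
  have "(norm (scaleC a x))\<^sup>2 = (cmod a * norm x)\<^sup>2"
    by (simp add: scaleC_prod_def norm_prod_def norm_scaleC power_mult_distrib algebra_simps)
  then show "norm (scaleC a x) = cmod a * norm x"
    by (simp add: power2_eq_iff_nonneg)
qed

end

definition bounded_clinear :: "('a::complex_normed_vector \<Rightarrow> 'b::complex_normed_vector) \<Rightarrow> bool" where
  "bounded_clinear A \<longleftrightarrow> bounded_linear A \<and> (\<forall>c x. A (scaleC c x) = scaleC c (A x))"

definition shifted :: "('a::complex_normed_vector \<Rightarrow> 'a) \<Rightarrow> complex \<Rightarrow> 'a \<Rightarrow> 'a" where
  "shifted A c = (\<lambda>x. A x - scaleC c x)"

text \<open>Invertibility is meant in the algebra of bounded operators.\<close>

definition invertible_op :: "('a::complex_normed_vector \<Rightarrow> 'a) \<Rightarrow> bool" where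
  "invertible_op T \<longleftrightarrow> (\<exists>S. bounded_clinear S \<and> S \<circ> T = id \<and> T \<circ> S = id)"

definition op_spectrum :: "('a::complex_normed_vector \<Rightarrow> 'a) \<Rightarrow> complex set" where
  "op_spectrum A = {c. \<not> invertible_op (shifted A c)}"

definition point_spectrum :: "('a::complex_normed_vector \<Rightarrow> 'a) \<Rightarrow> complex set" where
  "point_spectrum A = {c. \<not> inj (shifted A c)}"

definition continuous_spectrum :: "('a::complex_normed_vector \<Rightarrow> 'a) \<Rightarrow> complex set" where
  "continuous_spectrum A =
    {c. inj (shifted A c) \<and> closure (range (shifted A c)) = UNIV \<and> range (shifted A c) \<noteq> UNIV}"

definition residual_spectrum :: "('a::complex_normed_vector \<Rightarrow> 'a) \<Rightarrow> complex set" where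
  "residual_spectrum A = {c. inj (shifted A c) \<and> closure (range (shifted A c)) \<noteq> UNIV}"

abbreviation sqint :: "(real \<Rightarrow> complex) \<Rightarrow> bool" where
  "sqint f \<equiv> in_Lp 2 MI f"

lemma sqint_zero: "sqint (\<lambda>_. 0)"
  by (simp add: in_Lp_def)

lemma sqint_add:
  assumes "sqint f" "sqint g"
  shows "sqint (\<lambda>x. f x + g x)"
proof -
  have m: "f \<in> borel_measurable MI" "g \<in> borel_measurable MI"
    using assms by (auto simp: in_Lp_def)
  have "integrable MI (\<lambda>x. (cmod (f x + g x))\<^sup>2)"
  proof (rule Bochner_Integration.integrable_bound)
    show "integrable MI (\<lambda>x. 2 * (cmod (f x))\<^sup>2 + 2 * (cmod (g x))\<^sup>2)"
      using assms by (auto simp: in_Lp_def)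
    show "(\<lambda>x. (cmod (f x + g x))\<^sup>2) \<in> borel_measurable MI"
      using m by measurable
    have "(cmod (a + b))\<^sup>2 \<le> 2 * (cmod a)\<^sup>2 + 2 * (cmod b)\<^sup>2" for a b
    proof -
      have "(cmod (a + b))\<^sup>2 \<le> (cmod a + cmod b)\<^sup>2"
        by (intro power_mono norm_triangle_ineq) auto
      also have "\<dots> \<le> 2 * (cmod a)\<^sup>2 + 2 * (cmod b)\<^sup>2"
        using zero_le_power2[of "cmod a - cmod b"] by (simp add: power2_eq_square algebra_simps)
      finally show ?thesis .
    qed
    then show "AE x in MI. norm ((cmod (f x + g x))\<^sup>2)
        \<le> norm (2 * (cmod (f x))\<^sup>2 + 2 * (cmod (g x))\<^sup>2)"
      by auto
  qed
  then show ?thesis using m by (auto simp: in_Lp_def)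
qed

lemma sqint_cmult:
  assumes "sqint f"
  shows "sqint (\<lambda>x. c * f x)"
  using assms by (auto simp: in_Lp_def norm_mult power_mult_distrib)

lemma sqint_uminus: "sqint f \<Longrightarrow> sqint (\<lambda>x. - f x)"
  using sqint_cmult[of f "-1"] by simp

lemma sqint_diff: "sqint f \<Longrightarrow> sqint g \<Longrightarrow> sqint (\<lambda>x. f x - g x)"
  using sqint_add[OF _ sqint_uminus, of f g] by simp

lemma sqint_const: "sqint (\<lambda>_. c)"
proof -
  have "finite_measure MI"
    by (intro finite_measure_lebesgue_on) auto
  then show ?thesis
    by (simp add: in_Lp_def finite_measure.integrable_const)
qed

lemma sqint_Linf_mult:
  assumes f: "sqint f" and w: "in_Linf MI (w :: real \<Rightarrow> real)"
  shows "sqint (\<lambda>x. complex_of_real (w x) * f x)"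
proof -
  have m: "f \<in> borel_measurable MI" "w \<in> borel_measurable MI"
    using assms by (auto simp: in_Lp_def in_Linf_def)
  obtain C where C: "AE x in MI. norm (w x) \<le> C"
    using w by (auto simp: in_Linf_def)
  have "integrable MI (\<lambda>x. (cmod (complex_of_real (w x) * f x))\<^sup>2)"
  proof (rule Bochner_Integration.integrable_bound)
    show "integrable MI (\<lambda>x. C\<^sup>2 * (cmod (f x))\<^sup>2)"
      using f by (auto simp: in_Lp_def)
    show "(\<lambda>x. (cmod (complex_of_real (w x) * f x))\<^sup>2) \<in> borel_measurable MI"
      using m by measurable
    show "AE x in MI. norm ((cmod (complex_of_real (w x) * f x))\<^sup>2)
        \<le> norm (C\<^sup>2 * (cmod (f x))\<^sup>2)"
      using C
    proof eventually_elim
      case (elim x)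
      have "(\<bar>w x\<bar>)\<^sup>2 \<le> C\<^sup>2" using elim by (intro power_mono) auto
      then show ?case
        by (simp add: norm_mult power_mult_distrib mult_right_mono)
    qed
  qed
  then show ?thesis using m by (auto simp: in_Lp_def)
qed

lemma integrable_inner_sqint:
  assumes "sqint f" "sqint g"
  shows "integrable MI (\<lambda>x. inner (f x) (g x))"
proof (rule Bochner_Integration.integrable_bound)
  have m: "f \<in> borel_measurable MI" "g \<in> borel_measurable MI"
    using assms by (auto simp: in_Lp_def)
  show "integrable MI (\<lambda>x. (cmod (f x))\<^sup>2 + (cmod (g x))\<^sup>2)"
    using assms by (auto simp: in_Lp_def)
  show "(\<lambda>x. inner (f x) (g x)) \<in> borel_measurable MI"
    using m by measurable
  have "\<bar>inner a b\<bar> \<le> (cmod a)\<^sup>2 + (cmod b)\<^sup>2" for a b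
  proof -
    have "\<bar>inner a b\<bar> \<le> cmod a * cmod b" by (rule Cauchy_Schwarz_ineq2)
    also have "\<dots> \<le> 2 * (cmod a * cmod b)" by simp
    also have "\<dots> \<le> (cmod a)\<^sup>2 + (cmod b)\<^sup>2"
      using zero_le_power2[of "cmod a - cmod b"] by (simp add: power2_eq_square algebra_simps)
    finally show ?thesis .
  qed
  then show "AE x in MI. norm (inner (f x) (g x)) \<le> norm ((cmod (f x))\<^sup>2 + (cmod (g x))\<^sup>2)"
    by auto
qed

lemma integrable_sqint:
  assumes "sqint f"
  shows "integrable MI f"
proof (rule Bochner_Integration.integrable_bound)
  have 1: "sqint (\<lambda>_. 1)" by (rule sqint_const)
  show "integrable MI (\<lambda>x. (cmod (f x))\<^sup>2 + (cmod 1)\<^sup>2)"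
    using assms 1 unfolding in_Lp_def by (intro Bochner_Integration.integrable_add) auto
  show "f \<in> borel_measurable MI" using assms by (auto simp: in_Lp_def)
  have "t \<le> t\<^sup>2 + 1" for t :: real
    using zero_le_power2[of "t - 1 / 2"]
    by (simp add: power2_eq_square algebra_simps)
  then show "AE x in MI. norm (f x) \<le> norm ((cmod (f x))\<^sup>2 + (cmod 1)\<^sup>2)"
    by auto
qed

definition eq_L2 :: "(real \<Rightarrow> complex) \<Rightarrow> (real \<Rightarrow> complex) \<Rightarrow> bool" where
  "eq_L2 f g \<longleftrightarrow> sqint f \<and> sqint g \<and> (AE x in MI. f x = g x)"

text \<open>\<open>L2\<close> is the space of complex-valued square integrable functions on \<open>(0,1)\<close> modulo equality
  a.e. On square integrable functions \<open>class_L2\<close> is the class, and \<open>fun_L2\<close> picks a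
  representative of a class.\<close>

quotient_type L2 = "real \<Rightarrow> complex" / partial: eq_L2
  morphisms fun_L2 class_L2
proof (rule part_equivpI)
  show "\<exists>x. eq_L2 x x"
    by (rule exI[of _ "\<lambda>_. 0"]) (simp add: eq_L2_def sqint_zero)
  show "symp eq_L2"
    by (rule sympI) (auto simp: eq_L2_def)
  show "transp eq_L2"
  proof (rule transpI)
    fix f g h assume "eq_L2 f g" "eq_L2 g h"
    then show "eq_L2 f h"
      unfolding eq_L2_def by (auto elim: eventually_elim2)
  qed
qed

lemma sqint_fun_L2: "sqint (fun_L2 x)"
  using Quotient_rep_reflp[OF Quotient_L2, of x] by (simp add: eq_L2_def)

lemma borel_measurable_fun_L2: "fun_L2 x \<in> borel_measurable MI"
  using sqint_fun_L2[of x] by (simp add: in_Lp_def)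

lemma class_fun_L2: "class_L2 (fun_L2 x) = x"
  by (rule Quotient_abs_rep[OF Quotient_L2])

lemma class_L2_eq_iff: "sqint f \<Longrightarrow> sqint g \<Longrightarrow> class_L2 f = class_L2 g \<longleftrightarrow> (AE x in MI. f x = g x)"
  using Quotient_rel[OF Quotient_L2, of f g] by (auto simp: eq_L2_def)

lemma fun_class_L2: "sqint f \<Longrightarrow> AE x in MI. fun_L2 (class_L2 f) x = f x"
  using class_L2_eq_iff[of "fun_L2 (class_L2 f)" f] class_fun_L2 sqint_fun_L2 by auto

lemma L2_eqI: "(AE x in MI. fun_L2 a x = fun_L2 b x) \<Longrightarrow> a = b"
  using class_L2_eq_iff[OF sqint_fun_L2 sqint_fun_L2, of a b] by (simp add: class_fun_L2)

instantiation L2 :: real_vector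
begin

definition zero_L2 :: L2 where "0 = class_L2 (\<lambda>_. 0)"
definition plus_L2 :: "L2 \<Rightarrow> L2 \<Rightarrow> L2" where
  "a + b = class_L2 (\<lambda>x. fun_L2 a x + fun_L2 b x)"
definition minus_L2 :: "L2 \<Rightarrow> L2 \<Rightarrow> L2" where
  "a - b = class_L2 (\<lambda>x. fun_L2 a x - fun_L2 b x)"
definition uminus_L2 :: "L2 \<Rightarrow> L2" where
  "- a = class_L2 (\<lambda>x. - fun_L2 a x)"
definition scaleR_L2 :: "real \<Rightarrow> L2 \<Rightarrow> L2" where
  "scaleR r a = class_L2 (\<lambda>x. complex_of_real r * fun_L2 a x)"

lemma fun_zero_L2: "AE x in MI. fun_L2 0 x = 0"
  unfolding zero_L2_def by (rule fun_class_L2[OF sqint_zero])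

lemma fun_plus_L2: "AE x in MI. fun_L2 (a + b) x = fun_L2 a x + fun_L2 b x"
  unfolding plus_L2_def by (rule fun_class_L2[OF sqint_add[OF sqint_fun_L2 sqint_fun_L2]])

lemma fun_minus_L2: "AE x in MI. fun_L2 (a - b) x = fun_L2 a x - fun_L2 b x"
  unfolding minus_L2_def by (rule fun_class_L2[OF sqint_diff[OF sqint_fun_L2 sqint_fun_L2]])

lemma fun_uminus_L2: "AE x in MI. fun_L2 (- a) x = - fun_L2 a x"
  unfolding uminus_L2_def by (rule fun_class_L2[OF sqint_uminus[OF sqint_fun_L2]])

lemma fun_scaleR_L2: "AE x in MI. fun_L2 (scaleR r a) x = complex_of_real r * fun_L2 a x"
  unfolding scaleR_L2_def by (rule fun_class_L2[OF sqint_cmult[OF sqint_fun_L2]])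

instance
proof
  fix a b c :: L2 and r s :: real
  show "a + b + c = a + (b + c)"
    by (rule L2_eqI)
      (use fun_plus_L2[of "a + b" c] fun_plus_L2[of a b] fun_plus_L2[of a "b + c"] fun_plus_L2[of b c]
        in eventually_elim, simp)
  show "a + b = b + a"
    by (rule L2_eqI) (use fun_plus_L2[of a b] fun_plus_L2[of b a] in eventually_elim, simp)
  show "0 + a = a"
    by (rule L2_eqI) (use fun_plus_L2[of 0 a] fun_zero_L2 in eventually_elim, simp)
  show "- a + a = 0"
    by (rule L2_eqI)
      (use fun_plus_L2[of "- a" a] fun_uminus_L2[of a] fun_zero_L2 in eventually_elim, simp)
  show "a - b = a + - b"
    by (rule L2_eqI)
      (use fun_plus_L2[of a "- b"] fun_uminus_L2[of b] fun_minus_L2[of a b] in eventually_elim, simp)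
  show "r *\<^sub>R (a + b) = r *\<^sub>R a + r *\<^sub>R b"
    by (rule L2_eqI)
      (use fun_scaleR_L2[of r "a + b"] fun_plus_L2[of a b] fun_plus_L2[of "r *\<^sub>R a" "r *\<^sub>R b"]
         fun_scaleR_L2[of r a] fun_scaleR_L2[of r b] in eventually_elim, simp add: algebra_simps)
  show "(r + s) *\<^sub>R a = r *\<^sub>R a + s *\<^sub>R a"
    by (rule L2_eqI)
      (use fun_scaleR_L2[of "r + s" a] fun_plus_L2[of "r *\<^sub>R a" "s *\<^sub>R a"]
         fun_scaleR_L2[of r a] fun_scaleR_L2[of s a] in eventually_elim, simp add: algebra_simps)
  show "r *\<^sub>R s *\<^sub>R a = (r * s) *\<^sub>R a"
    by (rule L2_eqI)
      (use fun_scaleR_L2[of "r * s" a] fun_scaleR_L2[of r "s *\<^sub>R a"] fun_scaleR_L2[of s a]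
        in eventually_elim, simp add: algebra_simps)
  show "1 *\<^sub>R a = a"
    by (rule L2_eqI) (use fun_scaleR_L2[of 1 a] in eventually_elim, simp)
qed

end

instantiation L2 :: real_inner
begin

text \<open>This is the real part of the usual complex inner product.\<close>
definition inner_L2 :: "L2 \<Rightarrow> L2 \<Rightarrow> real" where
  "inner a b = (LINT x|MI. inner (fun_L2 a x) (fun_L2 b x))"
definition norm_L2 :: "L2 \<Rightarrow> real" where
  "norm a = sqrt (LINT x|MI. (cmod (fun_L2 a x))\<^sup>2)"
definition sgn_L2 :: "L2 \<Rightarrow> L2" where "sgn (a::L2) = a /\<^sub>R norm a"
definition dist_L2 :: "L2 \<Rightarrow> L2 \<Rightarrow> real" where "dist a b = norm (a - b :: L2)"
definition uniformity_L2 :: "(L2 \<times> L2) filter" where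
  "uniformity_L2 = (INF e\<in>{0<..}. principal {(a, b :: L2). dist a b < e})"
definition open_L2 :: "L2 set \<Rightarrow> bool" where
  "open_L2 U = (\<forall>a\<in>U. eventually (\<lambda>(a', b). a' = a \<longrightarrow> b \<in> U) uniformity)"

instance
proof
  fix a b c :: L2 and r :: real
  note m = borel_measurable_fun_L2
  show "dist a b = norm (a - b)" by (rule dist_L2_def)
  show "sgn a = a /\<^sub>R norm a" by (rule sgn_L2_def)
  show "uniformity = (INF e\<in>{0<..}. principal {(a, b :: L2). dist a b < e})"
    by (rule uniformity_L2_def)
  show "open U = (\<forall>a\<in>U. eventually (\<lambda>(a', b). a' = a \<longrightarrow> b \<in> U) uniformity)" for U :: "L2 set"
    by (rule open_L2_def)
  show "inner a b = inner b a"
    by (simp add: inner_L2_def inner_commute)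
  have "inner (a + b) c = (LINT x|MI. inner (fun_L2 a x) (fun_L2 c x) + inner (fun_L2 b x) (fun_L2 c x))"
    unfolding inner_L2_def
  proof (rule integral_cong_AE)
    show "(\<lambda>x. inner (fun_L2 (a + b) x) (fun_L2 c x)) \<in> borel_measurable MI"
      by (intro borel_measurable_inner m)
    show "(\<lambda>x. inner (fun_L2 a x) (fun_L2 c x) + inner (fun_L2 b x) (fun_L2 c x)) \<in> borel_measurable MI"
      by (intro borel_measurable_add borel_measurable_inner m)
    show "AE x in MI. inner (fun_L2 (a + b) x) (fun_L2 c x)
        = inner (fun_L2 a x) (fun_L2 c x) + inner (fun_L2 b x) (fun_L2 c x)"
      using fun_plus_L2[of a b] by eventually_elim (simp add: inner_add_left)
  qed
  also have "\<dots> = inner a c + inner b c"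
    unfolding inner_L2_def
    by (intro Bochner_Integration.integral_add integrable_inner_sqint sqint_fun_L2)
  finally show "inner (a + b) c = inner a c + inner b c" .
  have "inner (r *\<^sub>R a) b = (LINT x|MI. r * inner (fun_L2 a x) (fun_L2 b x))"
    unfolding inner_L2_def
  proof (rule integral_cong_AE)
    show "(\<lambda>x. inner (fun_L2 (r *\<^sub>R a) x) (fun_L2 b x)) \<in> borel_measurable MI"
      by (intro borel_measurable_inner m)
    show "(\<lambda>x. r * inner (fun_L2 a x) (fun_L2 b x)) \<in> borel_measurable MI"
      by (intro borel_measurable_times borel_measurable_const borel_measurable_inner m)
    show "AE x in MI. inner (fun_L2 (r *\<^sub>R a) x) (fun_L2 b x) = r * inner (fun_L2 a x) (fun_L2 b x)"
      using fun_scaleR_L2[of r a]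
      by eventually_elim (simp add: inner_complex_def algebra_simps)
  qed
  then show "inner (r *\<^sub>R a) b = r * inner a b"
    by (simp add: inner_L2_def)
  show "0 \<le> inner a a"
    by (simp add: inner_L2_def)
  have "inner a a = 0 \<longleftrightarrow> (AE x in MI. inner (fun_L2 a x) (fun_L2 a x) = 0)"
    unfolding inner_L2_def
    by (intro integral_nonneg_eq_0_iff_AE integrable_inner_sqint sqint_fun_L2) auto
  also have "\<dots> \<longleftrightarrow> (AE x in MI. fun_L2 a x = 0)"
    by simp
  also have "\<dots> \<longleftrightarrow> a = 0"
  proof
    assume "AE x in MI. fun_L2 a x = 0"
    then have "AE x in MI. fun_L2 a x = fun_L2 0 x"
      using fun_zero_L2 by eventually_elim simp
    then show "a = 0" by (rule L2_eqI)
  qed (use fun_zero_L2 in simp)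
  finally show "inner a a = 0 \<longleftrightarrow> a = 0" .
  show "norm a = sqrt (inner a a)"
    by (simp add: norm_L2_def inner_L2_def power2_norm_eq_inner)
qed

end

instantiation L2 :: complex_normed_vector
begin

definition scaleC_L2 :: "complex \<Rightarrow> L2 \<Rightarrow> L2" where
  "scaleC c a = class_L2 (\<lambda>x. c * fun_L2 a x)"

lemma fun_scaleC_L2: "AE x in MI. fun_L2 (scaleC c a) x = c * fun_L2 a x"
  unfolding scaleC_L2_def by (rule fun_class_L2[OF sqint_cmult[OF sqint_fun_L2]])

instance
proof
  fix a b :: complex and r :: real and x y :: L2
  show "scaleC a (x + y) = scaleC a x + scaleC a y"
    by (rule L2_eqI)
      (use fun_scaleC_L2[of a "x + y"] fun_plus_L2[of x y] fun_plus_L2[of "scaleC a x" "scaleC a y"]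
         fun_scaleC_L2[of a x] fun_scaleC_L2[of a y] in eventually_elim, simp add: algebra_simps)
  show "scaleC (a + b) x = scaleC a x + scaleC b x"
    by (rule L2_eqI)
      (use fun_scaleC_L2[of "a + b" x] fun_plus_L2[of "scaleC a x" "scaleC b x"]
         fun_scaleC_L2[of a x] fun_scaleC_L2[of b x] in eventually_elim, simp add: algebra_simps)
  show "scaleC a (scaleC b x) = scaleC (a * b) x"
    by (rule L2_eqI)
      (use fun_scaleC_L2[of "a * b" x] fun_scaleC_L2[of a "scaleC b x"] fun_scaleC_L2[of b x]
        in eventually_elim, simp add: algebra_simps)
  show "scaleC 1 x = x"
    by (rule L2_eqI) (use fun_scaleC_L2[of 1 x] in eventually_elim, simp)
  show "scaleR r x = scaleC (complex_of_real r) x"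
    by (simp add: scaleR_L2_def scaleC_L2_def)
  have "(LINT t|MI. (cmod (fun_L2 (scaleC a x) t))\<^sup>2) = (LINT t|MI. (cmod a)\<^sup>2 * (cmod (fun_L2 x t))\<^sup>2)"
  proof (rule integral_cong_AE)
    show "(\<lambda>t. (cmod (fun_L2 (scaleC a x) t))\<^sup>2) \<in> borel_measurable MI"
      using borel_measurable_fun_L2[of "scaleC a x"] by measurable
    show "(\<lambda>t. (cmod a)\<^sup>2 * (cmod (fun_L2 x t))\<^sup>2) \<in> borel_measurable MI"
      using borel_measurable_fun_L2[of x] by measurable
    show "AE t in MI. (cmod (fun_L2 (scaleC a x) t))\<^sup>2 = (cmod a)\<^sup>2 * (cmod (fun_L2 x t))\<^sup>2"
      using fun_scaleC_L2[of a x] by eventually_elim (simp add: norm_mult power_mult_distrib)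
  qed
  then show "norm (scaleC a x) = cmod a * norm x"
    by (simp add: norm_L2_def real_sqrt_mult)
qed

end

definition A0 :: "real \<Rightarrow> (real \<Rightarrow> real) \<Rightarrow> (real \<Rightarrow> real) \<Rightarrow> L2 \<times> L2 \<Rightarrow> L2 \<times> L2" where
  "A0 g u H = (\<lambda>(\<phi>1, \<phi>2).
     (class_L2 (\<lambda>x. of_real (u x) * fun_L2 \<phi>1 x + of_real (H x) * fun_L2 \<phi>2 x),
      class_L2 (\<lambda>x. of_real g * (LINT y|MI. fun_L2 \<phi>1 y) + of_real (u x) * fun_L2 \<phi>2 x)))"

text \<open>For bounded coefficients the representatives above are square integrable, and \<open>A0\<close> is a
  bounded complex-linear operator.\<close>

context
begin

private definition mul_L2 :: "(real \<Rightarrow> real) \<Rightarrow> L2 \<Rightarrow> L2" where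
  "mul_L2 w a = class_L2 (\<lambda>x. of_real (w x) * fun_L2 a x)"

private definition mean_L2 :: "L2 \<Rightarrow> L2" where
  "mean_L2 a = class_L2 (\<lambda>x. LINT y|MI. fun_L2 a y)"

private lemma fun_mul_L2:
  "in_Linf MI w \<Longrightarrow> AE x in MI. fun_L2 (mul_L2 w a) x = of_real (w x) * fun_L2 a x"
  unfolding mul_L2_def by (rule fun_class_L2[OF sqint_Linf_mult[OF sqint_fun_L2]])

private lemma fun_mean_L2: "AE x in MI. fun_L2 (mean_L2 a) x = (LINT y|MI. fun_L2 a y)"
  unfolding mean_L2_def by (rule fun_class_L2[OF sqint_const])

private lemma bounded_clinear_mul_L2:
  assumes w: "in_Linf MI w"
  shows "bounded_clinear (mul_L2 w)"
proof -
  obtain C0 where C0: "AE x in MI. \<bar>w x\<bar> \<le> C0"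
    using w by (auto simp: in_Linf_def)
  define C where "C = max C0 0"
  have C: "AE x in MI. \<bar>w x\<bar> \<le> C" and C_nonneg: "0 \<le> C"
    using C0 unfolding C_def by (auto elim: eventually_mono)
  have cl: "mul_L2 w (scaleC c a) = scaleC c (mul_L2 w a)" for c a
    by (rule L2_eqI)
      (use fun_mul_L2[OF w, of "scaleC c a"] fun_mul_L2[OF w, of a] fun_scaleC_L2[of c a]
         fun_scaleC_L2[of c "mul_L2 w a"] in eventually_elim, simp add: algebra_simps)
  have "bounded_linear (mul_L2 w)"
  proof (rule bounded_linear_intro)
    fix a b :: L2 and r :: real
    show "mul_L2 w (a + b) = mul_L2 w a + mul_L2 w b"
      by (rule L2_eqI)
        (use fun_mul_L2[OF w, of "a + b"] fun_mul_L2[OF w, of a] fun_mul_L2[OF w, of b]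
           fun_plus_L2[of a b] fun_plus_L2[of "mul_L2 w a" "mul_L2 w b"]
          in eventually_elim, simp add: algebra_simps)
    show "mul_L2 w (r *\<^sub>R a) = r *\<^sub>R mul_L2 w a"
      by (simp add: scaleR_eq_scaleC cl)
    have int: "integrable MI (\<lambda>x. (cmod (fun_L2 a x))\<^sup>2)" for a
      using sqint_fun_L2[of a] by (simp add: in_Lp_def)
    have "(LINT x|MI. (cmod (fun_L2 (mul_L2 w a) x))\<^sup>2) \<le> (LINT x|MI. C\<^sup>2 * (cmod (fun_L2 a x))\<^sup>2)"
    proof (rule integral_mono_AE)
      show "integrable MI (\<lambda>x. C\<^sup>2 * (cmod (fun_L2 a x))\<^sup>2)"
        by (intro integrable_mult_right int)
      show "AE x in MI. (cmod (fun_L2 (mul_L2 w a) x))\<^sup>2 \<le> C\<^sup>2 * (cmod (fun_L2 a x))\<^sup>2"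
        using C fun_mul_L2[OF w, of a]
      proof eventually_elim
        case (elim x)
        have "\<bar>w x\<bar>\<^sup>2 \<le> C\<^sup>2" using elim by (intro power_mono) auto
        then show ?case
          using elim by (simp add: norm_mult power_mult_distrib mult_right_mono)
      qed
    qed (rule int)
    also have "\<dots> = C\<^sup>2 * (LINT x|MI. (cmod (fun_L2 a x))\<^sup>2)"
      by simp
    finally have "norm (mul_L2 w a) \<le> sqrt (C\<^sup>2 * (LINT x|MI. (cmod (fun_L2 a x))\<^sup>2))"
      unfolding norm_L2_def by (rule real_sqrt_le_mono)
    then show "norm (mul_L2 w a) \<le> norm a * C"
      using C_nonneg by (simp add: norm_L2_def real_sqrt_mult mult.commute)
  qed
  with cl show ?thesis by (simp add: bounded_clinear_def)
qed

private lemma bounded_clinear_mean_L2: "bounded_clinear mean_L2"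
proof -
  have int: "integrable MI (fun_L2 a)" for a
    by (intro integrable_sqint sqint_fun_L2)
  have cl: "mean_L2 (scaleC c a) = scaleC c (mean_L2 a)" for c a
  proof -
    have "(LINT y|MI. fun_L2 (scaleC c a) y) = (LINT y|MI. c * fun_L2 a y)"
      by (intro integral_cong_AE borel_measurable_times borel_measurable_const
          borel_measurable_fun_L2 fun_scaleC_L2)
    then have "(LINT y|MI. fun_L2 (scaleC c a) y) = c * (LINT y|MI. fun_L2 a y)"
      by simp
    then show ?thesis
      by (intro L2_eqI)
        (use fun_mean_L2[of "scaleC c a"] fun_mean_L2[of a] fun_scaleC_L2[of c "mean_L2 a"]
          in eventually_elim, simp)
  qed
  define e1 where "e1 = class_L2 (\<lambda>_. 1)"
  define ei where "ei = class_L2 (\<lambda>_. \<i>)"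
  have e1: "AE x in MI. fun_L2 e1 x = 1" and ei: "AE x in MI. fun_L2 ei x = \<i>"
    unfolding e1_def ei_def by (intro fun_class_L2 sqint_const)+
  have ie1: "inner a e1 = Re (LINT y|MI. fun_L2 a y)" for a
  proof -
    have "inner a e1 = (LINT y|MI. Re (fun_L2 a y))"
      unfolding inner_L2_def
    proof (rule integral_cong_AE)
      show "(\<lambda>x. inner (fun_L2 a x) (fun_L2 e1 x)) \<in> borel_measurable MI"
        by (intro borel_measurable_inner borel_measurable_fun_L2)
      show "(\<lambda>x. Re (fun_L2 a x)) \<in> borel_measurable MI"
        using borel_measurable_fun_L2[of a] by measurable
      show "AE x in MI. inner (fun_L2 a x) (fun_L2 e1 x) = Re (fun_L2 a x)"
        using e1 by eventually_elim (simp add: inner_complex_def)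
    qed
    then show ?thesis using int by simp
  qed
  have iei: "inner a ei = Im (LINT y|MI. fun_L2 a y)" for a
  proof -
    have "inner a ei = (LINT y|MI. Im (fun_L2 a y))"
      unfolding inner_L2_def
    proof (rule integral_cong_AE)
      show "(\<lambda>x. inner (fun_L2 a x) (fun_L2 ei x)) \<in> borel_measurable MI"
        by (intro borel_measurable_inner borel_measurable_fun_L2)
      show "(\<lambda>x. Im (fun_L2 a x)) \<in> borel_measurable MI"
        using borel_measurable_fun_L2[of a] by measurable
      show "AE x in MI. inner (fun_L2 a x) (fun_L2 ei x) = Im (fun_L2 a x)"
        using ei by eventually_elim (simp add: inner_complex_def)
    qed
    then show ?thesis using int by simp
  qed
  have "mean_L2 = (\<lambda>a. inner a e1 *\<^sub>R e1 + inner a ei *\<^sub>R ei)"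
  proof
    fix a
    show "mean_L2 a = inner a e1 *\<^sub>R e1 + inner a ei *\<^sub>R ei"
      by (rule L2_eqI)
        (use fun_mean_L2[of a] fun_plus_L2[of "inner a e1 *\<^sub>R e1" "inner a ei *\<^sub>R ei"]
          fun_scaleR_L2[of "inner a e1" e1] fun_scaleR_L2[of "inner a ei" ei] e1 ei
          in eventually_elim, simp add: ie1 iei complex_eq_iff)
  qed
  moreover have "bounded_linear (\<lambda>a. inner a e1 *\<^sub>R e1 + inner a ei *\<^sub>R ei)"
    by (intro bounded_linear_add bounded_linear_scaleR_const bounded_linear_inner_left)
  ultimately show ?thesis using cl by (simp add: bounded_clinear_def)
qed

lemma bounded_clinear_A0:
  assumes u: "in_Linf MI u" and H: "in_Linf MI H"
  shows "bounded_clinear (A0 g u H)"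
proof -
  have "A0 g u H p = (mul_L2 u (fst p) + mul_L2 H (snd p), g *\<^sub>R mean_L2 (fst p) + mul_L2 u (snd p))" for p
  proof -
    obtain a b where p: "p = (a, b)" by (cases p)
    note sq = sqint_Linf_mult[OF sqint_fun_L2]
    have 1: "class_L2 (\<lambda>x. of_real (u x) * fun_L2 a x + of_real (H x) * fun_L2 b x)
        = mul_L2 u a + mul_L2 H b"
      by (rule L2_eqI)
        (use fun_class_L2[OF sqint_add[OF sq[OF u, of a] sq[OF H, of b]]]
           fun_plus_L2[of "mul_L2 u a" "mul_L2 H b"] fun_mul_L2[OF u, of a] fun_mul_L2[OF H, of b]
          in eventually_elim, simp)
    have 2: "class_L2 (\<lambda>x. of_real g * (LINT y|MI. fun_L2 a y) + of_real (u x) * fun_L2 b x)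
        = g *\<^sub>R mean_L2 a + mul_L2 u b"
      by (rule L2_eqI)
        (use fun_class_L2[OF sqint_add[OF sqint_const sq[OF u, of b]],
             of "of_real g * (LINT y|MI. fun_L2 a y)"]
           fun_plus_L2[of "g *\<^sub>R mean_L2 a" "mul_L2 u b"] fun_mul_L2[OF u, of b]
           fun_scaleR_L2[of g "mean_L2 a"] fun_mean_L2[of a]
          in eventually_elim, simp)
    show ?thesis by (simp add: A0_def p 1 2)
  qed
  then have eq: "A0 g u H =
      (\<lambda>p. (mul_L2 u (fst p) + mul_L2 H (snd p), g *\<^sub>R mean_L2 (fst p) + mul_L2 u (snd p)))"
    by blast
  have bl: "bounded_linear (mul_L2 u)" "bounded_linear (mul_L2 H)" "bounded_linear mean_L2"
    using bounded_clinear_mul_L2[OF u] bounded_clinear_mul_L2[OF H] bounded_clinear_mean_L2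
    by (auto simp: bounded_clinear_def)
  have cl: "mul_L2 u (scaleC c a) = scaleC c (mul_L2 u a)"
    "mul_L2 H (scaleC c a) = scaleC c (mul_L2 H a)" "mean_L2 (scaleC c a) = scaleC c (mean_L2 a)" for c a
    using bounded_clinear_mul_L2[OF u] bounded_clinear_mul_L2[OF H] bounded_clinear_mean_L2
    by (auto simp: bounded_clinear_def)
  have "bounded_linear (A0 g u H)"
    unfolding eq
    by (intro bounded_linear_Pair bounded_linear_add
        bounded_linear_compose[OF bl(1)] bounded_linear_compose[OF bl(2)]
        bounded_linear_compose[OF bounded_linear_scaleR_right]
        bounded_linear_compose[OF bl(3)] bounded_linear_fst bounded_linear_snd)
  moreover have "A0 g u H (scaleC c p) = scaleC c (A0 g u H p)" for c p
    by (simp add: eq scaleC_prod_def cl scaleC_add_right scaleR_eq_scaleC scaleC_scaleC mult.commute)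
  ultimately show ?thesis by (simp add: bounded_clinear_def)
qed

end

definition dispersion_integral :: "real \<Rightarrow> (real \<Rightarrow> real) \<Rightarrow> (real \<Rightarrow> real) \<Rightarrow> complex \<Rightarrow> complex" where
  "dispersion_integral g u H c =
     (LINT x|MI. of_real (g * H x) / (c - of_real (u x))\<^sup>2)"

end

theory Submission
  imports Defs
begin

text \<open>
  Write \<open>v = u - c\<close>. Eliminating \<open>\<phi>\<^sub>1\<close> and \<open>\<phi>\<^sub>2\<close> from \<open>(A\<^sub>0 - c) \<phi> = f\<close> by dividing by \<open>v\<close> leaves one scalar
  equation for the mean of \<open>\<phi>\<^sub>1\<close>, whose coefficient is one minus the dispersion integral. This gives the
  eigenvalues with \<open>v \<noteq> 0\<close> a.e., where \<open>\<phi>\<^sub>1\<close> is a multiple of \<open>g H / v\<^sup>2\<close>, and the bounded inverse off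
  the essential range. On a level set of positive measure, any \<open>\<phi>\<^sub>1\<close> of mean zero with \<open>\<phi>\<^sub>2 = 0\<close> is an
  eigenfunction.

  If \<open>c\<close> is in the essential range and not an eigenvalue, surjectivity would make every square integrable
  \<open>f\<close> equal to a constant plus a multiple of \<open>v\<close> by a square integrable function, which fails for a
  suitably concentrated \<open>f\<close>. The range is still dense: cutting off near \<open>v = 0\<close> puts the pairs
  \<open>(0, b - \<ell>(b))\<close> in it, where \<open>\<ell>(b)\<close> is the integral of \<open>g H b / v\<^sup>2\<close>. If \<open>\<ell>\<close> is bounded on
  square integrable functions, then \<open>b \<mapsto> b - \<ell>(b)\<close> is onto, because \<open>\<ell>(1) \<noteq> 1\<close>; otherwise the
  kernel of \<open>\<ell>\<close> is dense.

  If \<open>u\<close> is Hoelder continuous of index \<open>1/4\<close>, then \<open>\<bar>u(x) - u(x\<^sub>0)\<bar>\<^sup>-\<^sup>4\<close> dominates a multiple of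
  \<open>1 / \<bar>x - x\<^sub>0\<bar>\<close>, which is not integrable.
\<close>

section \<open>Square integrable functions on the unit interval\<close>

lemma space_MI [simp]: "space MI = I01"
  by simp

lemma sqint_dominated:
  assumes "sqint f" "h \<in> borel_measurable MI" "AE x in MI. cmod (h x) \<le> C * cmod (f x)"
  shows "sqint h"
proof -
  have "integrable MI (\<lambda>x. (cmod (h x))\<^sup>2)"
  proof (rule Bochner_Integration.integrable_bound)
    show "integrable MI (\<lambda>x. C\<^sup>2 * (cmod (f x))\<^sup>2)"
      using assms(1) by (simp add: in_Lp_def)
    show "(\<lambda>x. (cmod (h x))\<^sup>2) \<in> borel_measurable MI"
      using assms(2) by measurable
    show "AE x in MI. norm ((cmod (h x))\<^sup>2) \<le> norm (C\<^sup>2 * (cmod (f x))\<^sup>2)"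
      using assms(3)
    proof eventually_elim
      case (elim x)
      then have "(cmod (h x))\<^sup>2 \<le> (C * cmod (f x))\<^sup>2"
        by (intro power_mono) auto
      then show ?case by (simp add: power_mult_distrib)
    qed
  qed
  then show ?thesis using assms(2) by (simp add: in_Lp_def)
qed

lemma sqint_bounded:
  assumes "h \<in> borel_measurable MI" "AE x in MI. cmod (h x) \<le> C"
  shows "sqint h"
  by (rule sqint_dominated[OF sqint_const[of 1] assms(1), of C]) (use assms(2) in simp)

lemma integrable_mult_sqint:
  assumes "sqint f" "sqint h"
  shows "integrable MI (\<lambda>x. f x * h x)"
proof (rule Bochner_Integration.integrable_bound)
  have [measurable]: "f \<in> borel_measurable MI" "h \<in> borel_measurable MI"
    using assms by (auto simp: in_Lp_def)
  show "integrable MI (\<lambda>x. (cmod (f x))\<^sup>2 + (cmod (h x))\<^sup>2)"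
    using assms by (simp add: in_Lp_def)
  show "(\<lambda>x. f x * h x) \<in> borel_measurable MI" by measurable
  have "cmod a * cmod b \<le> (cmod a)\<^sup>2 + (cmod b)\<^sup>2" for a b
  proof -
    have "cmod a * cmod b \<le> 2 * cmod a * cmod b" by simp
    also have "\<dots> \<le> (cmod a)\<^sup>2 + (cmod b)\<^sup>2" by (rule sum_squares_bound)
    finally show ?thesis .
  qed
  then show "AE x in MI. norm (f x * h x) \<le> norm ((cmod (f x))\<^sup>2 + (cmod (h x))\<^sup>2)"
    by (simp add: norm_mult)
qed

lemma L2_eq_iff: "a = b \<longleftrightarrow> (AE x in MI. fun_L2 a x = fun_L2 b x)"
  using L2_eqI by auto

lemma integral_cong_fun_L2:
  assumes "sqint f" "h \<in> borel_measurable MI"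
  shows "(LINT x|MI. h x * fun_L2 (class_L2 f) x) = (LINT x|MI. h x * f x)"
proof (rule integral_cong_AE)
  have [measurable]: "f \<in> borel_measurable MI" "fun_L2 (class_L2 f) \<in> borel_measurable MI"
    "h \<in> borel_measurable MI"
    using assms borel_measurable_fun_L2 by (auto simp: in_Lp_def)
  show "(\<lambda>x. h x * fun_L2 (class_L2 f) x) \<in> borel_measurable MI"
    "(\<lambda>x. h x * f x) \<in> borel_measurable MI"
    by measurable
  show "AE x in MI. h x * fun_L2 (class_L2 f) x = h x * f x"
    using fun_class_L2[OF assms(1)] by eventually_elim simp
qed

lemma norm_class_L2:
  assumes "sqint f"
  shows "(norm (class_L2 f))\<^sup>2 = (LINT x|MI. (cmod (f x))\<^sup>2)"
proof -
  have [measurable]: "f \<in> borel_measurable MI" "fun_L2 (class_L2 f) \<in> borel_measurable MI"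
    using assms borel_measurable_fun_L2 by (auto simp: in_Lp_def)
  have "(LINT x|MI. (cmod (fun_L2 (class_L2 f) x))\<^sup>2) = (LINT x|MI. (cmod (f x))\<^sup>2)"
  proof (rule integral_cong_AE)
    show "AE x in MI. (cmod (fun_L2 (class_L2 f) x))\<^sup>2 = (cmod (f x))\<^sup>2"
      using fun_class_L2[OF assms] by eventually_elim simp
  qed measurable
  then show ?thesis by (simp add: norm_L2_def)
qed

lemma class_L2_add:
  assumes "sqint f" "sqint h"
  shows "class_L2 f + class_L2 h = class_L2 (\<lambda>x. f x + h x)"
  by (rule L2_eqI)
    (use fun_plus_L2[of "class_L2 f" "class_L2 h"] fun_class_L2[OF assms(1)]
       fun_class_L2[OF assms(2)] fun_class_L2[OF sqint_add[OF assms]] in eventually_elim, simp)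

lemma class_L2_diff:
  assumes "sqint f" "sqint h"
  shows "class_L2 f - class_L2 h = class_L2 (\<lambda>x. f x - h x)"
  by (rule L2_eqI)
    (use fun_minus_L2[of "class_L2 f" "class_L2 h"] fun_class_L2[OF assms(1)]
       fun_class_L2[OF assms(2)] fun_class_L2[OF sqint_diff[OF assms]] in eventually_elim, simp)

text \<open>The square of the modulus of \<open>1 / f^2\<close> is the fourth power of that of
  \<open>1 / f\<close>. This turns the \<open>L^4\<close> condition of the theorem into square
  integrability of the first component of an eigenvector.\<close>

lemma inverse_in_L4_iff:
  assumes [measurable]: "f \<in> borel_measurable MI"
  shows "inverse_in_Lp 4 MI f \<longleftrightarrow> (AE x in MI. f x \<noteq> 0) \<and> sqint (\<lambda>x. 1 / (f x)\<^sup>2)"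
proof -
  have "(cmod (1 / (f x)\<^sup>2))\<^sup>2 = cmod (inverse (f x)) ^ 4" for x
    by (simp add: norm_divide norm_power norm_inverse power_divide field_simps flip: power_mult)
  then show ?thesis
    unfolding inverse_in_Lp_def in_Lp_def by simp
qed

section \<open>Integral functionals and multiplication operators on \<open>L2\<close>\<close>

definition integral_L2 :: "(real \<Rightarrow> complex) \<Rightarrow> L2 \<Rightarrow> complex" where
  "integral_L2 w a = (LINT x|MI. w x * fun_L2 a x)"

lemma integral_L2_class: "sqint w \<Longrightarrow> sqint f \<Longrightarrow> integral_L2 w (class_L2 f) = (LINT x|MI. w x * f x)"
  unfolding integral_L2_def by (rule integral_cong_fun_L2) (auto simp: in_Lp_def)

text \<open>The pairing has no conjugate, whereas \<open>inner\<close> is the real part of the usual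
  inner product. Its real and imaginary parts are therefore the inner products with
  \<open>cnj w\<close> and \<open>\<i> * cnj w\<close>, and both are bounded.\<close>

lemma bounded_linear_integral_L2:
  assumes w: "sqint w"
  shows "bounded_linear (integral_L2 w)"
proof -
  have wm [measurable]: "w \<in> borel_measurable MI" using w by (simp add: in_Lp_def)
  have w1: "sqint (\<lambda>x. cnj (w x))"
  proof (rule sqint_dominated[OF w, of _ 1])
    have "(\<lambda>x. complex_of_real (Re (w x)) - \<i> * complex_of_real (Im (w x))) \<in> borel_measurable MI"
      by measurable
    moreover have "complex_of_real (Re z) - \<i> * complex_of_real (Im z) = cnj z" for z
      by (simp add: complex_eq_iff)
    ultimately show "(\<lambda>x. cnj (w x)) \<in> borel_measurable MI"
      by simp
  qed simp
  have w2: "sqint (\<lambda>x. \<i> * cnj (w x))"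
    by (rule sqint_cmult[OF w1])
  have inn: "inner a (class_L2 f) = (LINT x|MI. inner (fun_L2 a x) (f x))" if "sqint f" for a f
    unfolding inner_L2_def
  proof (rule integral_cong_AE)
    have [measurable]: "f \<in> borel_measurable MI" using that by (simp add: in_Lp_def)
    note borel_measurable_fun_L2[measurable]
    show "(\<lambda>x. inner (fun_L2 a x) (fun_L2 (class_L2 f) x)) \<in> borel_measurable MI"
      "(\<lambda>x. inner (fun_L2 a x) (f x)) \<in> borel_measurable MI"
      by measurable
    show "AE x in MI. inner (fun_L2 a x) (fun_L2 (class_L2 f) x) = inner (fun_L2 a x) (f x)"
      using fun_class_L2[OF that] by eventually_elim simp
  qed
  have "integral_L2 w a = inner a (class_L2 (\<lambda>x. cnj (w x))) *\<^sub>R 1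
      + inner a (class_L2 (\<lambda>x. \<i> * cnj (w x))) *\<^sub>R \<i>" for a
  proof -
    have int: "integrable MI (\<lambda>x. w x * fun_L2 a x)"
      by (rule integrable_mult_sqint[OF w sqint_fun_L2])
    have "Re (integral_L2 w a) = (LINT x|MI. Re (w x * fun_L2 a x))"
      "Im (integral_L2 w a) = (LINT x|MI. Im (w x * fun_L2 a x))"
      unfolding integral_L2_def by (rule integral_Re[OF int, symmetric] integral_Im[OF int, symmetric])+
    then show ?thesis
      by (simp add: inn[OF w1] inn[OF w2] complex_eq_iff inner_complex_def algebra_simps)
  qed
  then have "integral_L2 w = (\<lambda>a. inner a (class_L2 (\<lambda>x. cnj (w x))) *\<^sub>R 1
      + inner a (class_L2 (\<lambda>x. \<i> * cnj (w x))) *\<^sub>R \<i>)"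
    by blast
  then show ?thesis
    by (auto intro!: bounded_linear_add bounded_linear_scaleR_const bounded_linear_inner_left)
qed

lemma integral_L2_scaleC: "integral_L2 w (scaleC c a) = c * integral_L2 w a"
  if "sqint w"
proof -
  have [measurable]: "w \<in> borel_measurable MI" using that by (simp add: in_Lp_def)
  note borel_measurable_fun_L2[measurable]
  have "integral_L2 w (scaleC c a) = (LINT x|MI. c * (w x * fun_L2 a x))"
    unfolding integral_L2_def
  proof (rule integral_cong_AE)
    show "AE x in MI. w x * fun_L2 (scaleC c a) x = c * (w x * fun_L2 a x)"
      using fun_scaleC_L2[of c a] by eventually_elim simp
  qed measurable
  then show ?thesis by (simp add: integral_L2_def)
qed

text \<open>The symbol is complex-valued because \<open>1 / (c - u)\<close> has to be allowed for
  nonreal \<open>c\<close>.\<close>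

definition mult_L2 :: "(real \<Rightarrow> complex) \<Rightarrow> L2 \<Rightarrow> L2" where
  "mult_L2 w a = class_L2 (\<lambda>x. w x * fun_L2 a x)"

lemma
  assumes w: "in_Linf MI w"
  shows sqint_mult_Linf: "sqint f \<Longrightarrow> sqint (\<lambda>x. w x * f x)"
    and fun_mult_L2: "AE x in MI. fun_L2 (mult_L2 w a) x = w x * fun_L2 a x"
    and bounded_clinear_mult_L2: "bounded_clinear (mult_L2 w)"
proof -
  have [measurable]: "w \<in> borel_measurable MI" using w by (simp add: in_Linf_def)
  obtain C where C: "AE x in MI. cmod (w x) \<le> C"
    using w by (auto simp: in_Linf_def)
  define C' where "C' = max C 0"
  have C': "AE x in MI. cmod (w x) \<le> C'" and C'0: "0 \<le> C'"
    using C by (auto simp: C'_def elim: eventually_mono)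
  show sq: "sqint (\<lambda>x. w x * f x)" if f: "sqint f" for f
  proof (rule sqint_dominated[OF f, of _ C])
    have [measurable]: "f \<in> borel_measurable MI" using f by (simp add: in_Lp_def)
    show "(\<lambda>x. w x * f x) \<in> borel_measurable MI" by measurable
    show "AE x in MI. cmod (w x * f x) \<le> C * cmod (f x)"
      using C by eventually_elim (simp add: norm_mult mult_right_mono)
  qed
  show ae: "AE x in MI. fun_L2 (mult_L2 w a) x = w x * fun_L2 a x" for a
    unfolding mult_L2_def by (rule fun_class_L2[OF sq[OF sqint_fun_L2]])
  have cl: "mult_L2 w (scaleC c a) = scaleC c (mult_L2 w a)" for c a
    by (rule L2_eqI)
      (use ae[of "scaleC c a"] ae[of a] fun_scaleC_L2[of c a]
         fun_scaleC_L2[of c "mult_L2 w a"] in eventually_elim, simp add: algebra_simps)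
  have "bounded_linear (mult_L2 w)"
  proof (rule bounded_linear_intro)
    fix a b :: L2 and r :: real
    show "mult_L2 w (a + b) = mult_L2 w a + mult_L2 w b"
      by (rule L2_eqI)
        (use ae[of "a + b"] ae[of a] ae[of b]
           fun_plus_L2[of a b] fun_plus_L2[of "mult_L2 w a" "mult_L2 w b"]
          in eventually_elim, simp add: algebra_simps)
    show "mult_L2 w (r *\<^sub>R a) = r *\<^sub>R mult_L2 w a"
      by (simp add: scaleR_eq_scaleC cl)
    have int: "integrable MI (\<lambda>x. (cmod (fun_L2 a x))\<^sup>2)" for a
      using sqint_fun_L2[of a] by (simp add: in_Lp_def)
    have "(norm (mult_L2 w a))\<^sup>2 \<le> (LINT x|MI. C'\<^sup>2 * (cmod (fun_L2 a x))\<^sup>2)"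
      unfolding norm_L2_def real_sqrt_pow2[OF Bochner_Integration.integral_nonneg[OF zero_le_power2]]
    proof (rule integral_mono_AE)
      show "AE x in MI. (cmod (fun_L2 (mult_L2 w a) x))\<^sup>2 \<le> C'\<^sup>2 * (cmod (fun_L2 a x))\<^sup>2"
        using C' ae[of a]
        by eventually_elim (simp add: norm_mult power_mult_distrib mult_right_mono power_mono)
    qed (use int in simp_all)
    also have "\<dots> = (C' * norm a)\<^sup>2"
      by (simp add: norm_L2_def power_mult_distrib)
    finally show "norm (mult_L2 w a) \<le> norm a * C'"
      using C'0 by (simp add: power2_le_iff_abs_le mult.commute)
  qed
  with cl show "bounded_clinear (mult_L2 w)" by (simp add: bounded_clinear_def)
qed

lemma bounded_linear_scaleC_left: "bounded_linear (\<lambda>z. scaleC z (e :: 'a::complex_normed_vector))"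
proof (rule bounded_linear_intro[where K = "norm e"])
  fix x y :: complex and r :: real
  show "scaleC (x + y) e = scaleC x e + scaleC y e" by (rule scaleC_add_left)
  show "scaleC (r *\<^sub>R x) e = r *\<^sub>R scaleC x e"
    by (simp add: scaleR_eq_scaleC scaleC_scaleC scaleR_conv_of_real)
  show "norm (scaleC x e) \<le> norm x * norm e" by (simp add: norm_scaleC)
qed

lemma scaleC_diff_right: "scaleC k (x - y) = scaleC k x - scaleC k (y :: 'a::complex_normed_vector)"
  using scaleC_add_right[of k "x - y" y] by (simp add: algebra_simps)

lemma finite_measure_MI: "finite_measure MI"
  by (intro finite_measure_lebesgue_on) auto

lemma AE_MI_neq: "AE x in MI. x \<noteq> s"
proof -
  have "{s} \<in> null_sets lebesgue" by simp
  then have "AE x in lebesgue. x \<noteq> s" using AE_not_in[of "{s}" lebesgue] by simp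
  then show ?thesis by (simp add: AE_restrict_space_iff eventually_mono)
qed

lemma class_L2_zero_pair: "(class_L2 (\<lambda>_. 0), class_L2 (\<lambda>_. 0)) = (0 :: L2 \<times> L2)"
  by (simp add: zero_L2_def zero_prod_def)

text \<open>Dominated convergence with majorant \<open>\<bar>f x\<bar>\<close>. It serves for
  neighbourhoods of a level of \<open>u\<close> and for intervals shrinking to a point.\<close>

lemma tail_integral_tendsto_0:
  fixes f :: "'a \<Rightarrow> real"
  assumes f: "integrable M f" and B: "\<And>n. B n \<in> sets M"
    and ev: "AE x in M. eventually (\<lambda>n. x \<notin> B n) sequentially"
  shows "(\<lambda>n. LINT x|M. indicator (B n) x * f x) \<longlonglongrightarrow> 0"
proof -
  have [measurable]: "f \<in> borel_measurable M" "\<And>n. B n \<in> sets M" using f B by auto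
  have "(\<lambda>n. LINT x|M. indicator (B n) x * f x) \<longlonglongrightarrow> (LINT x|M. 0)"
  proof (rule integral_dominated_convergence[where w = "\<lambda>x. \<bar>f x\<bar>"])
    show "AE x in M. (\<lambda>n. indicator (B n) x * f x) \<longlonglongrightarrow> 0"
      using ev
    proof eventually_elim
      case (elim x)
      then have "eventually (\<lambda>n. indicator (B n) x * f x = 0) sequentially"
        by eventually_elim simp
      then show ?case by (rule tendsto_eventually)
    qed
    show "AE x in M. norm (indicator (B n) x * f x) \<le> \<bar>f x\<bar>" for n
      by (rule AE_I2) (simp add: indicator_def)
  qed (use f in simp_all)
  then show ?thesis by simp
qed

lemma class_L2_scaleC:
  assumes "sqint f"
  shows "scaleC c (class_L2 f) = class_L2 (\<lambda>x. c * f x)"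
  by (rule L2_eqI)
    (use fun_scaleC_L2[of c "class_L2 f"] fun_class_L2[OF assms] fun_class_L2[OF sqint_cmult[OF assms, of c]]
      in eventually_elim, simp)

lemma scaleC_zero_left: "scaleC 0 (x :: 'a::complex_normed_vector) = 0"
  using norm_scaleC[of 0 x] by simp

lemma invertible_op_bij: "invertible_op f \<Longrightarrow> inj f \<and> range f = UNIV"
  unfolding invertible_op_def by (metis bij_betw_def o_bij)

text \<open>The bound is \<open>\<delta>\<close> rather than twice \<open>\<delta>\<close> because
  \<open>x0\<close> may be an endpoint, where half of the interval falls outside.\<close>

lemma LINT_indicator_near:
  assumes "x0 \<in> {0..1}" "0 < \<delta>" "\<delta> \<le> 1"
  shows "\<delta> \<le> (LINT x|MI. indicator {x \<in> I01. \<bar>x - x0\<bar> < \<delta>} x)"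
proof -
  define a b where "a = max 0 (x0 - \<delta>)" and "b = min 1 (x0 + \<delta>)"
  have eq: "{x \<in> I01. \<bar>x - x0\<bar> < \<delta>} = {a<..<b}" by (auto simp: a_def b_def)
  have ab: "{a<..<b} \<subseteq> I01" by (auto simp: a_def b_def)
  have le: "\<delta> \<le> b - a" using assms by (auto simp: a_def b_def)
  have "(LINT x|MI. indicator {a<..<b} x) = measure MI {a<..<b}"
    by (simp only: Bochner_Integration.integral_indicator space_MI Int_absorb2[OF ab])
  also have "\<dots> = measure lebesgue {a<..<b}"
    using ab by (intro measure_restrict_space) auto
  also have "\<dots> = b - a" using le assms(2) by simp
  finally show ?thesis using le eq by simp
qed

lemma MI_near_sets: "{x \<in> I01. \<bar>x - x0\<bar> < \<delta>} \<in> sets MI"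
proof -
  have "{x \<in> I01. \<bar>x - x0\<bar> < \<delta>} = I01 \<inter> {x0 - \<delta><..<x0 + \<delta>}" by auto
  then show ?thesis
    unfolding sets_restrict_space by (rule image_eqI) simp
qed

lemma holder_on_imp_continuous_on:
  assumes "holder_on \<alpha> S f" "\<alpha> > 0"
  shows "continuous_on S f"
  unfolding continuous_on_def
proof
  fix x assume x: "x \<in> S"
  obtain C where C: "\<And>x y. x \<in> S \<Longrightarrow> y \<in> S \<Longrightarrow> \<bar>f x - f y\<bar> \<le> C * \<bar>x - y\<bar> powr \<alpha>"
    using assms(1) by (auto simp: holder_on_def)
  have "((\<lambda>y. C * \<bar>y - x\<bar> powr \<alpha>) \<longlongrightarrow> C * 0 powr \<alpha>) (at x within S)"
    using assms(2) by (intro tendsto_intros tendsto_powr' tendsto_rabs_zero LIM_zero) auto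
  then have lim: "((\<lambda>y. C * \<bar>y - x\<bar> powr \<alpha>) \<longlongrightarrow> 0) (at x within S)" by simp
  have "((\<lambda>y. f y - f x) \<longlongrightarrow> 0) (at x within S)"
    by (rule Lim_null_comparison[OF _ lim]) (use C x in \<open>auto simp: eventually_at_filter\<close>)
  then show "(f \<longlongrightarrow> f x) (at x within S)" by (rule LIM_zero_cancel)
qed

section \<open>The operator and its eigenvalues\<close>

locale shear_flow =
  fixes g :: real and u H :: "real \<Rightarrow> real"
  assumes g_pos: "g > 0"
    and u_Linf: "in_Linf MI u" and H_Linf: "in_Linf MI H"
    and H_pos: "essinf MI H > 0"
begin

abbreviation T :: "complex \<Rightarrow> L2 \<times> L2 \<Rightarrow> L2 \<times> L2" where
  "T c \<equiv> shifted (A0 g u H) c"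

lemma u_meas [measurable]: "u \<in> borel_measurable MI" and H_meas [measurable]: "H \<in> borel_measurable MI"
  using u_Linf H_Linf by (auto simp: in_Linf_def)

lemma H_lower: obtains \<delta> where "\<delta> > 0" "AE x in MI. \<delta> \<le> H x"
proof -
  let ?s = "esssup MI (\<lambda>x. - ereal (H x))"
  have "?s < 0" using H_pos by (simp add: essinf_def)
  \<comment> \<open>Choosing a real number strictly between avoids having to show that the essential
    supremum is finite; \<open>- r\<close> is then the lower bound.\<close>
  then obtain r where r: "?s < ereal r" "r < 0"
    using ereal_dense2[of ?s 0] by (auto simp: zero_ereal_def)
  have "AE x in MI. - r \<le> H x"
    using esssup_AE[of "\<lambda>x. - ereal (H x)" MI]
  proof eventually_elim
    case (elim x)
    then have "- ereal (H x) < ereal r" using r by (meson le_less_trans)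
    then show ?case by simp
  qed
  with r that[of "- r"] show ?thesis by simp
qed

lemma H_upper: obtains C where "C > 0" "AE x in MI. \<bar>H x\<bar> \<le> C"
proof -
  obtain C where "AE x in MI. \<bar>H x\<bar> \<le> C"
    using H_Linf by (auto simp: in_Linf_def)
  then have "AE x in MI. \<bar>H x\<bar> \<le> max C 1" by (auto elim: eventually_mono)
  then show ?thesis by (intro that[of "max C 1"]) auto
qed

lemma H_Linf_complex: "in_Linf MI (\<lambda>x. complex_of_real (H x))"
  using H_Linf by (auto simp: in_Linf_def)

lemma bounded_linear_T: "bounded_linear (T c)"
proof -
  have "bounded_linear (\<lambda>x. scaleC c x :: L2 \<times> L2)"
  proof (rule bounded_linear_intro[where K = "cmod c"])
    fix x y :: "L2 \<times> L2" and r :: real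
    show "scaleC c (x + y) = scaleC c x + scaleC c y" by (rule scaleC_add_right)
    show "scaleC c (r *\<^sub>R x) = r *\<^sub>R scaleC c x"
      by (simp add: scaleR_eq_scaleC scaleC_scaleC mult.commute)
    show "norm (scaleC c x) \<le> norm x * cmod c" by (simp add: norm_scaleC mult.commute)
  qed
  then show ?thesis
    unfolding shifted_def using bounded_clinear_A0[OF u_Linf H_Linf, of g]
    by (intro bounded_linear_sub) (auto simp: bounded_clinear_def)
qed

text \<open>Turns an operator equation between classes into two pointwise equations a.e., which can
  be solved by dividing by \<open>u - c\<close>.\<close>

lemma T_eq_iff:
  "T c (a, b) = (p, q) \<longleftrightarrow>
    (AE x in MI. (of_real (u x) - c) * fun_L2 a x + of_real (H x) * fun_L2 b x = fun_L2 p x) \<and>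
    (AE x in MI. of_real g * (LINT y|MI. fun_L2 a y) + (of_real (u x) - c) * fun_L2 b x = fun_L2 q x)"
proof -
  let ?F = "\<lambda>x. of_real (u x) * fun_L2 a x + of_real (H x) * fun_L2 b x"
  let ?G = "\<lambda>x. of_real g * (LINT y|MI. fun_L2 a y) + of_real (u x) * fun_L2 b x"
  have F: "sqint ?F" and G: "sqint ?G"
    by (intro sqint_add sqint_const sqint_Linf_mult sqint_fun_L2 u_Linf H_Linf)+
  have *: "class_L2 h - scaleC c z = p \<longleftrightarrow> (AE x in MI. h x - c * fun_L2 z x = fun_L2 p x)"
    if "sqint h" for h z p
    unfolding L2_eq_iff
  proof (rule eventually_subst)
    show "AE x in MI. (fun_L2 (class_L2 h - scaleC c z) x = fun_L2 p x)
        = (h x - c * fun_L2 z x = fun_L2 p x)"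
      using fun_minus_L2[of "class_L2 h" "scaleC c z"] fun_class_L2[OF that] fun_scaleC_L2[of c z]
      by eventually_elim simp
  qed
  have "T c (a, b) = (class_L2 ?F - scaleC c a, class_L2 ?G - scaleC c b)"
    by (simp add: shifted_def A0_def scaleC_prod_def)
  then show ?thesis
    using *[OF F, of a p] *[OF G, of b q] by (simp add: algebra_simps)
qed

text \<open>Serves to exhibit images of explicit functions without passing to the chosen
  representatives; the mean of \<open>a\<close> does not depend on the representative.\<close>

lemma T_class:
  assumes "sqint a" "sqint b" "sqint p" "sqint q"
    and "AE x in MI. (of_real (u x) - c) * a x + of_real (H x) * b x = p x"
    and "AE x in MI. of_real g * (LINT y|MI. a y) + (of_real (u x) - c) * b x = q x"
  shows "T c (class_L2 a, class_L2 b) = (class_L2 p, class_L2 q)"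
proof -
  have m: "(LINT y|MI. fun_L2 (class_L2 a) y) = (LINT y|MI. a y)"
    using integral_cong_fun_L2[OF assms(1), of "\<lambda>_. 1"] by simp
  note AE = fun_class_L2[OF assms(1)] fun_class_L2[OF assms(2)] fun_class_L2[OF assms(3)]
    fun_class_L2[OF assms(4)]
  show ?thesis
    unfolding T_eq_iff m
  proof
    show "AE x in MI. (of_real (u x) - c) * fun_L2 (class_L2 a) x + of_real (H x) * fun_L2 (class_L2 b) x
        = fun_L2 (class_L2 p) x"
      using AE assms(5) by eventually_elim simp
    show "AE x in MI. of_real g * (LINT y|MI. a y) + (of_real (u x) - c) * fun_L2 (class_L2 b) x
        = fun_L2 (class_L2 q) x"
      using AE assms(6) by eventually_elim simp
  qed
qed

section \<open>Eigenvalues, off and on level sets of positive measure\<close>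

lemma point_spectrum_iff:
  "c \<in> point_spectrum (A0 g u H) \<longleftrightarrow> (\<exists>a b. T c (a, b) = 0 \<and> (a, b) \<noteq> 0)"
  using bounded_linear.linear[OF bounded_linear_T[of c]]
  by (auto simp: point_spectrum_def linear_injective_0)

text \<open>The integrand of the dispersion integral is also the first component of an eigenvector
  when \<open>u\<close> differs from \<open>c\<close> a.e. Its value is 0 where \<open>u\<close>
  equals \<open>c\<close>, by the convention for division, so the \<open>L^4\<close> condition has
  to exclude that case separately.\<close>

definition kern :: "complex \<Rightarrow> real \<Rightarrow> complex" where
  "kern c x = of_real (g * H x) / (c - of_real (u x))\<^sup>2"

lemma kern_meas [measurable]: "kern c \<in> borel_measurable MI"
  unfolding kern_def by measurable

lemma dispersion_integral_eq: "dispersion_integral g u H c = (LINT x|MI. kern c x)"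
  by (simp add: dispersion_integral_def kern_def)

text \<open>\<open>H\<close> lies a.e. between two positive constants, so each function dominates
  the other up to a factor.\<close>

lemma sqint_kern_iff: "sqint (kern c) \<longleftrightarrow> sqint (\<lambda>x. 1 / (c - of_real (u x))\<^sup>2)"
proof
  obtain \<delta> where \<delta>: "\<delta> > 0" "AE x in MI. \<delta> \<le> H x" by (rule H_lower)
  assume "sqint (kern c)"
  then show "sqint (\<lambda>x. 1 / (c - of_real (u x))\<^sup>2)"
  proof (rule sqint_dominated)
    show "AE x in MI. cmod (1 / (c - of_real (u x))\<^sup>2) \<le> (1 / (g * \<delta>)) * cmod (kern c x)"
      using \<delta>(2)
    proof eventually_elim
      case (elim x)
      have "1 \<le> g * \<bar>H x\<bar> / (g * \<delta>)"
        using elim \<delta>(1) g_pos by (simp add: field_simps)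
      then have "1 * cmod (1 / (c - of_real (u x))\<^sup>2)
          \<le> g * \<bar>H x\<bar> / (g * \<delta>) * cmod (1 / (c - of_real (u x))\<^sup>2)"
        by (rule mult_right_mono) simp
      also have "\<dots> = (1 / (g * \<delta>)) * cmod (kern c x)"
        using g_pos by (simp add: kern_def norm_divide norm_mult abs_mult)
      finally show ?case by simp
    qed
  qed measurable
next
  obtain C where C: "AE x in MI. \<bar>H x\<bar> \<le> C" by (rule H_upper)
  assume "sqint (\<lambda>x. 1 / (c - of_real (u x))\<^sup>2)"
  then show "sqint (kern c)"
  proof (rule sqint_dominated)
    show "AE x in MI. cmod (kern c x) \<le> (g * C) * cmod (1 / (c - of_real (u x))\<^sup>2)"
      using C
    proof eventually_elim
      case (elim x)
      then show ?case
        using g_pos by (simp add: kern_def norm_divide norm_mult abs_mult divide_right_mono)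
    qed
  qed measurable
qed

lemma inverse_in_L4_iff_kern:
  "inverse_in_Lp 4 MI (\<lambda>x. c - complex_of_real (u x)) \<longleftrightarrow>
    (AE x in MI. of_real (u x) \<noteq> c) \<and> sqint (kern c)"
proof -
  have "(\<lambda>x. c - complex_of_real (u x)) \<in> borel_measurable MI" by measurable
  from inverse_in_L4_iff[OF this] show ?thesis
    by (simp add: sqint_kern_iff eq_commute[of c])
qed

text \<open>With zero right-hand side, the second row gives \<open>b\<close> in terms of the mean
  \<open>m\<close>, and the first row then gives \<open>a\<close>. The single number
  \<open>m\<close> stays undetermined.\<close>

lemma kernel_eqs:
  assumes ne: "AE x in MI. of_real (u x) \<noteq> c" and T0: "T c (a, b) = 0"
  defines "m \<equiv> LINT y|MI. fun_L2 a y"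
  shows "AE x in MI. fun_L2 b x = of_real g * m / (c - of_real (u x))"
    and "AE x in MI. fun_L2 a x = m * kern c x"
proof -
  have eqs: "AE x in MI. (of_real (u x) - c) * fun_L2 a x + of_real (H x) * fun_L2 b x = fun_L2 0 x"
    "AE x in MI. of_real g * m + (of_real (u x) - c) * fun_L2 b x = fun_L2 0 x"
    using T0 unfolding zero_prod_def T_eq_iff m_def by auto
  show 1: "AE x in MI. fun_L2 b x = of_real g * m / (c - of_real (u x))"
    using eqs(2) fun_zero_L2 ne
  proof eventually_elim
    case (elim x)
    then have "fun_L2 b x * (c - of_real (u x)) = of_real g * m" by algebra
    with elim(3) show ?case by (simp add: eq_divide_eq)
  qed
  show "AE x in MI. fun_L2 a x = m * kern c x"
    using eqs(1) fun_zero_L2 ne 1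
  proof eventually_elim
    case (elim x)
    then have "fun_L2 a x * (c - of_real (u x)) = of_real (H x) * fun_L2 b x" by algebra
    with elim(3) have "fun_L2 a x = of_real (H x) * fun_L2 b x / (c - of_real (u x))"
      by (simp add: eq_divide_eq)
    then show ?case using elim(4) by (simp add: kern_def power2_eq_square)
  qed
qed

text \<open>By \<open>kernel_eqs\<close> an eigenvector is fixed by the mean \<open>m\<close>, which
  cannot vanish. Hence \<open>kern c\<close> is square integrable, and integrating
  \<open>a = m * kern c\<close> gives the dispersion relation. Conversely, \<open>kern c\<close> and
  \<open>g / (c - u)\<close> form an eigenvector.\<close>

lemma point_spectrum_iff_sqint:
  assumes ne: "AE x in MI. of_real (u x) \<noteq> c"
  shows "c \<in> point_spectrum (A0 g u H) \<longleftrightarrow> sqint (kern c) \<and> dispersion_integral g u H c = 1"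
proof
  assume "c \<in> point_spectrum (A0 g u H)"
  then obtain a b where ab: "T c (a, b) = 0" "(a, b) \<noteq> 0"
    unfolding point_spectrum_iff by blast
  define m where "m = (LINT y|MI. fun_L2 a y)"
  note b = kernel_eqs(1)[OF ne ab(1), folded m_def] and a = kernel_eqs(2)[OF ne ab(1), folded m_def]
  have "m \<noteq> 0"
  proof
    assume "m = 0"
    have "a = 0"
      by (rule L2_eqI) (use a fun_zero_L2 in eventually_elim, simp add: \<open>m = 0\<close>)
    moreover have "b = 0"
      by (rule L2_eqI) (use b fun_zero_L2 in eventually_elim, simp add: \<open>m = 0\<close>)
    ultimately show False using ab(2) by (simp add: zero_prod_def)
  qed
  have "sqint (kern c)"
  proof (rule sqint_dominated[OF sqint_fun_L2])
    show "AE x in MI. cmod (kern c x) \<le> (1 / cmod m) * cmod (fun_L2 a x)"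
      using a by eventually_elim (simp add: norm_mult \<open>m \<noteq> 0\<close>)
  qed measurable
  moreover have "m = (LINT y|MI. m * kern c y)"
    unfolding m_def by (rule integral_cong_AE)
      (use a borel_measurable_fun_L2 in \<open>simp_all add: m_def\<close>)
  then have "dispersion_integral g u H c = 1"
    using \<open>m \<noteq> 0\<close> by (simp add: dispersion_integral_eq)
  ultimately show "sqint (kern c) \<and> dispersion_integral g u H c = 1" ..
next
  assume *: "sqint (kern c) \<and> dispersion_integral g u H c = 1"
  let ?b = "\<lambda>x. of_real g / (c - of_real (u x))"
  have b: "sqint ?b"
  proof (rule sqint_dominated)
    show "sqint (\<lambda>x. 1 + of_real (cmod (1 / (c - of_real (u x))\<^sup>2)))"
      by (intro sqint_add sqint_const, rule sqint_dominated[of "\<lambda>x. 1 / (c - of_real (u x))\<^sup>2" _ 1])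
        (use * in \<open>simp_all add: sqint_kern_iff\<close>)
    \<comment> \<open>Applied to \<open>w = 1 / (c - u)\<close>: on a space of finite measure,
      square integrability of \<open>w^2\<close> passes to \<open>w\<close>.\<close>
    have "cmod w \<le> 1 + cmod (w\<^sup>2)" for w :: complex
    proof -
      have "2 * cmod w \<le> (cmod w)\<^sup>2 + 1" using sum_squares_bound[of "cmod w" 1] by simp
      moreover have "0 \<le> (cmod w)\<^sup>2" by simp
      ultimately show ?thesis unfolding norm_power using norm_ge_zero[of w] by linarith
    qed
    from mult_left_mono[OF this, of g]
    have *: "g * cmod w \<le> g * cmod (1 + of_real (cmod (w\<^sup>2)))" for w :: complex
      using g_pos norm_of_real[of "1 + cmod (w\<^sup>2)", where 'a = complex]
      by (simp del: norm_of_real)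
    show "AE x in MI. cmod (?b x) \<le> g * cmod (1 + of_real (cmod (1 / (c - of_real (u x))\<^sup>2)))"
      using *[of "1 / (c - of_real (u _))"] g_pos by (simp add: norm_divide power_divide)
  qed measurable
  have "T c (class_L2 (kern c), class_L2 ?b) = 0"
    unfolding class_L2_zero_pair[symmetric]
  proof (rule T_class)
    show "AE x in MI. (of_real (u x) - c) * kern c x + of_real (H x) * ?b x = 0"
      using ne
    proof eventually_elim
      case (elim x)
      define d where "d = c - of_real (u x)"
      have "d \<noteq> 0" "of_real (u x) - c = - d" using elim by (auto simp: d_def)
      then show ?case
        unfolding kern_def d_def[symmetric] by (simp add: power2_eq_square)
    qed
    show "AE x in MI. of_real g * (LINT y|MI. kern c y) + (of_real (u x) - c) * ?b x = 0"
      using ne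
    proof eventually_elim
      case (elim x)
      define d where "d = c - of_real (u x)"
      have "d \<noteq> 0" "of_real (u x) - c = - d" using elim by (auto simp: d_def)
      then show ?case
        using * unfolding d_def[symmetric] dispersion_integral_eq by simp
    qed
  qed (use * b sqint_zero in auto)
  \<comment> \<open>A class with integral 1 is not zero.\<close>
  moreover have "class_L2 (kern c) \<noteq> 0"
  proof
    assume "class_L2 (kern c) = 0"
    then have "AE x in MI. kern c x = 0"
      using * by (simp add: zero_L2_def class_L2_eq_iff sqint_zero)
    then have "(LINT x|MI. kern c x) = (LINT x|MI. 0)"
      by (rule integral_cong_AE[OF kern_meas borel_measurable_const])
    then show False using * by (simp add: dispersion_integral_eq)
  qed
  ultimately show "c \<in> point_spectrum (A0 g u H)"
    unfolding point_spectrum_iff by (auto simp: zero_prod_def)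
qed

text \<open>On the level set \<open>u - c\<close> vanishes, so a function supported there with mean
  zero is annihilated when paired with second component 0. The function \<open>x - s\<close> on that
  set serves, and it vanishes at one point of the set at most.\<close>

lemma point_spectrum_level_set:
  assumes "\<not> (AE x in MI. of_real (u x) \<noteq> c)"
  shows "c \<in> point_spectrum (A0 g u H)"
proof -
  interpret finite_measure MI by (rule finite_measure_MI)
  define \<xi> :: "real \<Rightarrow> real" where "\<xi> x = (if of_real (u x) = c then 1 else 0)" for x
  have [measurable]: "\<xi> \<in> borel_measurable MI" unfolding \<xi>_def by measurable
  have idm [measurable]: "(\<lambda>x. x) \<in> borel_measurable MI"
    by (intro continuous_imp_measurable_on_sets_lebesgue continuous_intros) simp
  have int: "integrable MI \<xi>" "integrable MI (\<lambda>x. x * \<xi> x)"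
    by (rule integrable_const_bound[of _ 1], auto simp: \<xi>_def)+
  define \<mu> where "\<mu> = (LINT x|MI. \<xi> x)"
  \<comment> \<open>The barycentre of the level set, chosen to make the mean of
    \<open>(x - s) * \<xi> x\<close> zero.\<close>
  define s where "s = (LINT x|MI. x * \<xi> x) / \<mu>"
  have "\<mu> \<noteq> 0"
  proof
    assume "\<mu> = 0"
    then have "AE x in MI. \<xi> x = 0"
      unfolding \<mu>_def using int by (subst (asm) integral_nonneg_eq_0_iff_AE) (auto simp: \<xi>_def)
    then have "AE x in MI. of_real (u x) \<noteq> c"
      by eventually_elim (auto simp: \<xi>_def split: if_splits)
    with assms show False ..
  qed
  define a where "a x = complex_of_real ((x - s) * \<xi> x)" for x
  have [measurable]: "a \<in> borel_measurable MI" unfolding a_def by measurable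
  have a: "sqint a"
    by (rule sqint_bounded[of _ "1 + \<bar>s\<bar>"])
      (auto simp: a_def \<xi>_def intro!: AE_I2 simp del: of_real_mult)
  have "(LINT x|MI. (x - s) * \<xi> x) = (LINT x|MI. x * \<xi> x) - s * \<mu>"
    unfolding \<mu>_def using int by (simp add: left_diff_distrib)
  then have a0: "(LINT x|MI. a x) = 0"
    unfolding a_def integral_complex_of_real using \<open>\<mu> \<noteq> 0\<close> by (simp add: s_def)
  have "T c (class_L2 a, class_L2 (\<lambda>_. 0)) = 0"
    unfolding class_L2_zero_pair[symmetric]
  proof (rule T_class)
    show "AE x in MI. (of_real (u x) - c) * a x + of_real (H x) * 0 = 0"
      by (rule AE_I2) (simp add: a_def \<xi>_def)
  qed (simp_all add: a a0 sqint_zero)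
  moreover have "class_L2 a \<noteq> 0"
  proof
    assume "class_L2 a = 0"
    then have "AE x in MI. a x = 0"
      using a by (simp add: zero_L2_def class_L2_eq_iff sqint_zero)
    then have "AE x in MI. of_real (u x) \<noteq> c"
      using AE_MI_neq[of s] by eventually_elim (auto simp: a_def \<xi>_def)
    with assms show False ..
  qed
  ultimately show ?thesis
    unfolding point_spectrum_iff by (auto simp: zero_prod_def)
qed

section \<open>The essential range and the bounded inverse off it\<close>

lemma level_set_iff: "emeasure MI {x \<in> I01. u x = r} > 0 \<longleftrightarrow> \<not> (AE x in MI. u x \<noteq> r)"
proof -
  have "{x \<in> space MI. \<not> u x \<noteq> r} \<in> sets MI" by measurable
  then show ?thesis
    using AE_iff_measurable[of "{x \<in> I01. u x = r}" MI "\<lambda>x. u x \<noteq> r"]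
    by (simp add: zero_less_iff_neq_zero)
qed

lemma ess_range_iff: "r \<in> ess_range u \<longleftrightarrow> (\<forall>\<epsilon>>0. \<not> (AE x in MI. \<epsilon> \<le> \<bar>u x - r\<bar>))"
proof -
  have "emeasure MI {x\<in>I01. \<bar>u x - r\<bar> < \<epsilon>} \<noteq> 0 \<longleftrightarrow> \<not> (AE x in MI. \<epsilon> \<le> \<bar>u x - r\<bar>)" for \<epsilon>
  proof -
    have "{x \<in> space MI. \<not> \<epsilon> \<le> \<bar>u x - r\<bar>} \<in> sets MI" by measurable
    then show ?thesis
      using AE_iff_measurable[of "{x\<in>I01. \<bar>u x - r\<bar> < \<epsilon>}" MI "\<lambda>x. \<epsilon> \<le> \<bar>u x - r\<bar>"]
      by (simp add: not_le)
  qed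
  then show ?thesis by (simp add: ess_range_def)
qed

text \<open>For nonreal \<open>c\<close> the bound is the modulus of the imaginary part, because
  \<open>u\<close> is real; for real \<open>c\<close> it comes from the definition of the essential
  range.\<close>

lemma not_ess_range:
  assumes "c \<notin> complex_of_real ` ess_range u"
  obtains d where "d > 0" "AE x in MI. d \<le> cmod (c - of_real (u x))"
proof (cases "Im c = 0")
  case True
  then have c: "c = of_real (Re c)" by (simp add: complex_eq_iff)
  with assms have "Re c \<notin> ess_range u" by auto
  then obtain d where "d > 0" "AE x in MI. d \<le> \<bar>u x - Re c\<bar>"
    by (auto simp: ess_range_iff)
  moreover have "cmod (c - of_real t) = \<bar>t - Re c\<bar>" for t
    by (subst c, simp only: flip: of_real_diff) (simp only: norm_of_real abs_minus_commute)
  ultimately show ?thesis by (auto intro: that)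
next
  case False
  show ?thesis
  proof (rule that)
    show "\<bar>Im c\<bar> > 0" using False by simp
    show "AE x in MI. \<bar>Im c\<bar> \<le> cmod (c - of_real (u x))"
      using abs_Im_le_cmod[of "c - of_real (u _)"] by simp
  qed
qed

lemma not_ess_range_AE:
  assumes "c \<notin> complex_of_real ` ess_range u"
  shows "AE x in MI. of_real (u x) \<noteq> c"
    and "in_Linf MI (\<lambda>x. 1 / (c - of_real (u x)))" and "sqint (kern c)"
proof -
  obtain d where d: "d > 0" "AE x in MI. d \<le> cmod (c - of_real (u x))"
    using assms by (rule not_ess_range)
  show "AE x in MI. of_real (u x) \<noteq> c"
    using d(2) by eventually_elim (use d(1) in auto)
  have le: "AE x in MI. cmod (1 / (c - of_real (u x))) \<le> 1 / d"
    using d(2) by eventually_elim (use d(1) in \<open>auto simp: norm_divide intro!: divide_left_mono mult_pos_pos\<close>)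
  then show "in_Linf MI (\<lambda>x. 1 / (c - of_real (u x)))"
    unfolding in_Linf_def by auto
  have "sqint (\<lambda>x. 1 / (c - of_real (u x))\<^sup>2)"
  proof (rule sqint_bounded)
    show "AE x in MI. cmod (1 / (c - of_real (u x))\<^sup>2) \<le> (1 / d)\<^sup>2"
      using le
    proof eventually_elim
      case (elim x)
      then have "(cmod (1 / (c - of_real (u x))))\<^sup>2 \<le> (1 / d)\<^sup>2" by (intro power_mono) auto
      then show ?case by (simp add: norm_divide norm_power power_divide)
    qed
  qed measurable
  then show "sqint (kern c)" by (simp add: sqint_kern_iff)
qed

text \<open>\<open>S\<close> is the explicit inverse obtained by elimination:
  \<open>b = w (g m - f2)\<close> and \<open>a = w (H b - f1)\<close> with
  \<open>w = 1 / (c - u)\<close>, where \<open>m\<close> is still to be determined.\<close>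

lemma invertible_T:
  assumes c: "c \<notin> complex_of_real ` ess_range u" and D: "dispersion_integral g u H c \<noteq> 1"
  shows "invertible_op (T c)"
proof -
  define w where "w x = 1 / (c - of_real (u x))" for x
  let ?D = "dispersion_integral g u H c"
  let ?H = "\<lambda>x. complex_of_real (H x)"
  have ne: "AE x in MI. of_real (u x) \<noteq> c" and w: "in_Linf MI w" and k: "sqint (kern c)"
    using not_ess_range_AE[OF c] by (simp_all add: w_def[abs_def])
  have ws: "sqint w" using w by (auto simp: in_Linf_def intro: sqint_bounded)
  have hw: "sqint (\<lambda>x. w x * (?H x * w x))"
    by (intro sqint_mult_Linf w H_Linf_complex ws)
  have wH: "sqint (\<lambda>x. ?H x * w x)" by (intro sqint_mult_Linf H_Linf_complex ws)
  define L where "L f = integral_L2 (\<lambda>x. w x * (?H x * w x)) (snd f) + integral_L2 w (fst f)" for f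
  \<comment> \<open>Taking the mean of \<open>a\<close> gives \<open>m = m D - L f\<close>, which is
    solvable because \<open>D\<close> is not 1.\<close>
  define m where "m f = - L f / (1 - ?D)" for f
  define B where "B f = scaleC (of_real g * m f) (class_L2 w) - mult_L2 w (snd f)" for f
  define S where "S f = (mult_L2 w (mult_L2 ?H (B f) - fst f), B f)" for f
  have bl: "bounded_linear (mult_L2 w)" "bounded_linear (mult_L2 ?H)"
    using bounded_clinear_mult_L2[OF w] bounded_clinear_mult_L2[OF H_Linf_complex]
    by (auto simp: bounded_clinear_def)
  have "bounded_linear L"
    unfolding L_def
    by (intro bounded_linear_add bounded_linear_compose[OF bounded_linear_integral_L2]
        bounded_linear_fst bounded_linear_snd hw ws)
  moreover have "m = (\<lambda>f. L f * (- 1 / (1 - ?D)))" by (simp add: m_def fun_eq_iff)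
  ultimately have "bounded_linear m"
    by (simp only: bounded_linear_mult_const)
  then have "bounded_linear (\<lambda>f. scaleC (of_real g * m f) (class_L2 w))"
    by (intro bounded_linear_compose[OF bounded_linear_scaleC_left] bounded_linear_const_mult)
  then have blB: "bounded_linear B"
    unfolding B_def
    by (intro bounded_linear_sub bounded_linear_compose[OF bl(1)] bounded_linear_snd)
  then have blS: "bounded_linear S"
    unfolding S_def
    by (intro bounded_linear_Pair bounded_linear_compose[OF bl(1)] bounded_linear_sub
        bounded_linear_compose[OF bl(2)] bounded_linear_fst blB)
  have TS: "T c (S f) = f" for f
  proof -
    obtain f1 f2 where f: "f = (f1, f2)" by (cases f)
    let ?a = "mult_L2 w (mult_L2 ?H (B f) - f1)"
    have fB: "AE x in MI. fun_L2 (B f) x = w x * (of_real g * m f - fun_L2 f2 x)"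
      using fun_minus_L2[of "scaleC (of_real g * m f) (class_L2 w)" "mult_L2 w f2"]
        fun_scaleC_L2[of "of_real g * m f" "class_L2 w"] fun_class_L2[OF ws] fun_mult_L2[OF w, of f2]
      by eventually_elim (simp add: B_def f algebra_simps)
    have fa: "AE x in MI. fun_L2 ?a x = w x * (?H x * fun_L2 (B f) x - fun_L2 f1 x)"
      using fun_minus_L2[of "mult_L2 ?H (B f)" f1] fun_mult_L2[OF w, of "mult_L2 ?H (B f) - f1"]
        fun_mult_L2[OF H_Linf_complex, of "B f"]
      by eventually_elim simp
    \<comment> \<open>Consistency: the mean of the constructed first component has to be the number
      \<open>m f\<close> used to build it.\<close>
    have "(LINT x|MI. fun_L2 ?a x) = (LINT x|MI. m f * kern c x
        - (w x * (?H x * w x) * fun_L2 f2 x + w x * fun_L2 f1 x))"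
    proof (rule integral_cong_AE)
      have [measurable]: "w \<in> borel_measurable MI" using ws by (simp add: in_Lp_def)
      note borel_measurable_fun_L2[measurable]
      show "fun_L2 ?a \<in> borel_measurable MI"
        "(\<lambda>x. m f * kern c x - (w x * (?H x * w x) * fun_L2 f2 x + w x * fun_L2 f1 x)) \<in> borel_measurable MI"
        by measurable
      show "AE x in MI. fun_L2 ?a x = m f * kern c x
        - (w x * (?H x * w x) * fun_L2 f2 x + w x * fun_L2 f1 x)"
        using fa fB
        by eventually_elim (simp add: kern_def w_def power2_eq_square algebra_simps)
    qed
    also have "\<dots> = m f * ?D - L f"
      by (simp add: integrable_mult_sqint hw ws sqint_fun_L2 integrable_sqint k L_def f
          integral_L2_def dispersion_integral_eq)
    also have "\<dots> = m f"
      using D by (simp add: m_def field_simps)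
    finally have mean: "(LINT x|MI. fun_L2 ?a x) = m f" .
    show ?thesis
      unfolding S_def f fst_conv T_eq_iff
      unfolding f[symmetric] mean
    proof
      show "AE x in MI. (of_real (u x) - c) * fun_L2 ?a x + ?H x * fun_L2 (B f) x = fun_L2 f1 x"
        using fa ne by eventually_elim (simp add: w_def field_simps)
      show "AE x in MI. of_real g * m f + (of_real (u x) - c) * fun_L2 (B f) x = fun_L2 f2 x"
        using fB ne by eventually_elim (simp add: w_def field_simps)
    qed
  qed
  have "inj (T c)"
    using point_spectrum_iff_sqint[OF ne] D by (simp add: point_spectrum_def)
  \<comment> \<open>A right inverse of an injective map is also a left inverse: \<open>T c\<close>
    sends \<open>S (T c p)\<close> and \<open>p\<close> to the same element.\<close>
  then have ST: "S (T c p) = p" for p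
    by (rule injD) (rule TS)
  have "T c (scaleC k p) = scaleC k (T c p)" for k p
  proof -
    have "A0 g u H (scaleC k p) = scaleC k (A0 g u H p)"
      using bounded_clinear_A0[OF u_Linf H_Linf, of g] unfolding bounded_clinear_def by blast
    then show ?thesis
      by (simp add: shifted_def scaleC_scaleC mult.commute scaleC_diff_right)
  qed
  \<comment> \<open>Complex homogeneity of \<open>S\<close> is inherited from its inverse
    \<open>T c\<close>.\<close>
  then have "S (scaleC k f) = scaleC k (S f)" for k f
    using ST TS by metis
  then show ?thesis
    unfolding invertible_op_def bounded_clinear_def
    by (intro exI[of _ S]) (auto simp: blS TS ST fun_eq_iff)
qed

section \<open>The range over the essential range\<close>

lemma near_level_meas: "{x \<in> I01. \<bar>u x - r\<bar> \<le> t} \<in> sets MI"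
proof -
  have "{x \<in> space MI. \<bar>u x - r\<bar> \<le> t} \<in> sets MI" by measurable
  then show ?thesis by simp
qed

text \<open>\<open>Suc n\<close> keeps the radius positive at \<open>n = 0\<close>.\<close>

definition near :: "real \<Rightarrow> nat \<Rightarrow> real \<Rightarrow> bool" where
  "near r n x \<longleftrightarrow> \<bar>u x - r\<bar> \<le> 1 / real (Suc n)"

lemma near_mono: "n \<le> k \<Longrightarrow> near r k x \<Longrightarrow> near r n x"
  unfolding near_def by (erule order_trans) (simp add: frac_le)

lemma near_meas: "{x \<in> space MI. near r n x} \<in> sets MI"
  using near_level_meas[of r "1 / real (Suc n)"] by (simp add: near_def)

lemma eventually_not_near:
  assumes "u x \<noteq> r"
  shows "eventually (\<lambda>n. \<not> near r n x) sequentially"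
proof -
  have "eventually (\<lambda>n. 1 / real (Suc n) < \<bar>u x - r\<bar>) sequentially"
    using assms by (intro order_tendstoD[OF lim_1_over_n[THEN LIMSEQ_Suc]]) auto
  then show ?thesis by eventually_elim (simp add: near_def)
qed

text \<open>Away from the level, dividing by \<open>u - r\<close> costs at most the factor
  \<open>n + 1\<close>, so it preserves square integrability.\<close>

lemma not_near_bound:
  assumes "\<not> near r n x"
  shows "cmod (z / complex_of_real (u x - r)) \<le> real (Suc n) * cmod z"
proof -
  define t where "t = \<bar>u x - r\<bar>"
  have "0 < 1 / real (Suc n)" by simp
  then have "1 / real (Suc n) < t" "0 < t" using assms by (simp_all only: near_def t_def not_le)
  then have "1 / t \<le> real (Suc n)" by (simp add: field_simps del: of_nat_Suc)
  from mult_right_mono[OF this, of "cmod z"] show ?thesis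
    unfolding norm_divide norm_of_real t_def by simp
qed

text \<open>If \<open>(0, f)\<close> is attained, then \<open>f = m + (u - r) b\<close> with
  \<open>m\<close> constant and \<open>b\<close> square integrable. On sets where
  \<open>u - r\<close> is small this limits the mass of \<open>f\<close>, and the \<open>f\<close>
  constructed below has too much mass on a sequence of such sets.\<close>

lemma not_surj_T:
  assumes r: "r \<in> ess_range u" and ne: "AE x in MI. u x \<noteq> r"
  shows "range (T (of_real r)) \<noteq> UNIV"
proof
  assume surj: "range (T (of_real r)) = UNIV"
  interpret finite_measure MI by (rule finite_measure_MI)
  \<comment> \<open>The neighbourhoods of the level decrease to a null set, as \<open>u\<close>
    differs from \<open>r\<close> a.e., so both the radius and the measure can be made
    small.\<close>
  have "\<exists>s>0. s \<le> (1/2)^k \<and> (LINT x|MI. indicator {x \<in> I01. \<bar>u x - r\<bar> \<le> s} x) \<le> (1/8 :: real)^k" for k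
  proof -
    let ?B = "\<lambda>n. {x \<in> space MI. near r n x}"
    have "(\<lambda>n. LINT x|MI. indicator (?B n) x * 1) \<longlonglongrightarrow> (0::real)"
    proof (rule tail_integral_tendsto_0)
      show "integrable MI (\<lambda>_. 1 :: real)" by (rule integrable_const)
      show "AE x in MI. eventually (\<lambda>n. x \<notin> ?B n) sequentially"
        using ne
      proof eventually_elim
        case (elim x)
        from eventually_not_near[OF this] show ?case by eventually_elim simp
      qed
    qed (rule near_meas)
    then have "eventually (\<lambda>n. (LINT x|MI. indicator (?B n) x * 1) < (1/8 :: real)^k) sequentially"
      by (rule order_tendstoD) simp
    moreover have "eventually (\<lambda>n. 1 / real (Suc n) < (1/2)^k) sequentially"
      by (rule order_tendstoD[OF lim_1_over_n[THEN LIMSEQ_Suc]]) simp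
    ultimately have "eventually (\<lambda>n. (LINT x|MI. indicator (?B n) x * 1) < (1/8 :: real)^k
        \<and> 1 / real (Suc n) < (1/2)^k) sequentially"
      by (rule eventually_conj)
    then obtain n where "(LINT x|MI. indicator (?B n) x * 1) < (1/8 :: real)^k"
      "1 / real (Suc n) < (1/2)^k"
      by (auto simp: eventually_sequentially)
    then show ?thesis
      by (intro exI[of _ "1 / real (Suc n)"]) (auto simp: near_def)
  qed
  then have "\<exists>s. \<forall>k. s k > 0 \<and> s k \<le> (1/2)^k
      \<and> (LINT x|MI. indicator {x \<in> I01. \<bar>u x - r\<bar> \<le> s k} x) \<le> (1/8 :: real)^k"
    by (intro choice allI)
  then obtain s where s: "\<And>k. s k > 0" "\<And>k. s k \<le> (1/2)^k"
    and s8: "\<And>k. (LINT x|MI. indicator {x \<in> I01. \<bar>u x - r\<bar> \<le> s k} x) \<le> (1/8 :: real)^k"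
    by blast
  \<comment> \<open>The square of the function outside the range is the sum of the \<open>L\<^sup>1\<close>-normalised indicators of
    these sets with weights \<open>2\<^sup>-\<^sup>k\<close>.\<close>
  define B where "B k = {x \<in> I01. \<bar>u x - r\<bar> \<le> s k}" for k
  define \<beta> :: "nat \<Rightarrow> real" where "\<beta> k = (LINT x|MI. indicator (B k) x)" for k
  have B [measurable]: "B k \<in> sets MI" for k unfolding B_def by (rule near_level_meas)
  have intB: "integrable MI (indicator (B k) :: real \<Rightarrow> real)" for k
    by (rule integrable_const_bound[of _ 1]) (auto simp: indicator_def)
  have \<beta>8: "\<beta> k \<le> (1/8)^k" for k using s8 by (simp add: \<beta>_def B_def)
  \<comment> \<open>Membership of \<open>r\<close> in the essential range is what makes every
    \<open>B k\<close> non-null, so that normalising by \<open>\<beta> k\<close> is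
    possible.\<close>
  have \<beta>: "\<beta> k > 0" for k
  proof -
    have "\<beta> k \<noteq> 0"
    proof
      assume "\<beta> k = 0"
      then have "AE x in MI. indicator (B k) x = (0::real)"
        unfolding \<beta>_def using intB by (subst (asm) integral_nonneg_eq_0_iff_AE) auto
      moreover have "AE x in MI. x \<in> I01" using AE_space[of MI] by simp
      ultimately have "AE x in MI. s k \<le> \<bar>u x - r\<bar>"
        by eventually_elim (auto simp: B_def indicator_def split: if_splits)
      then show False using r s(1)[of k] by (auto simp: ess_range_iff)
    qed
    moreover have "\<beta> k \<ge> 0" unfolding \<beta>_def by (rule Bochner_Integration.integral_nonneg) simp
    ultimately show ?thesis by simp
  qed
  define e where "e k x = (1/2)^k / \<beta> k * indicator (B k) x" for k x
  have e_nonneg: "0 \<le> e k x" for k x using \<beta>[of k] by (simp add: e_def)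
  have e_int: "integrable MI (e k)" and e_LINT: "(LINT x|MI. e k x) = (1/2)^k" for k
    using intB \<beta>[of k] by (simp_all add: e_def[abs_def] \<beta>_def)
  \<comment> \<open>Off the level only finitely many terms are nonzero, because the radii
    \<open>s k\<close> tend to 0.\<close>
  have e_sum: "AE x in MI. summable (\<lambda>k. e k x)"
    using ne
  proof eventually_elim
    case (elim x)
    have "(\<lambda>k. (1/2 :: real)^k) \<longlonglongrightarrow> 0" by (rule LIMSEQ_realpow_zero) auto
    then have "eventually (\<lambda>k. (1/2)^k < \<bar>u x - r\<bar>) sequentially"
      using elim by (intro order_tendstoD) auto
    then have "eventually (\<lambda>k. norm (e k x) \<le> 0) sequentially"
    proof eventually_elim
      case (elim k)
      then show ?case using s(2)[of k] by (simp add: e_def B_def)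
    qed
    then show ?case
      by (rule summable_comparison_test_ev) simp
  qed
  define h where "h x = (\<Sum>k. e k x)" for x
  have h_int: "integrable MI h"
    unfolding h_def
  proof (rule integrable_suminf[OF e_int])
    show "AE x in MI. summable (\<lambda>k. norm (e k x))" using e_sum e_nonneg by simp
    show "summable (\<lambda>k. LINT x|MI. norm (e k x))"
      using e_nonneg by (simp add: e_LINT)
  qed
  have h_ge: "AE x in MI. \<forall>k. e k x \<le> h x"
    using e_sum
  proof eventually_elim
    case (elim x)
    show ?case
    proof
      fix k
      have "(\<Sum>i\<in>{k}. e i x) \<le> (\<Sum>i. e i x)"
        by (rule sum_le_suminf[OF elim]) (auto simp: e_nonneg)
      then show "e k x \<le> h x" by (simp add: h_def)
    qed
  qed
  define f where "f x = complex_of_real (sqrt (h x))" for x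
  have cf: "(cmod (f x))\<^sup>2 = \<bar>h x\<bar>" for x
    by (simp add: f_def flip: real_sqrt_abs2)
  have fm: "f \<in> borel_measurable MI" using h_int unfolding f_def by measurable
  have f: "sqint f"
    unfolding in_Lp_def using fm h_int by (simp add: cf)
  obtain a b where "T (of_real r) (a, b) = (0, class_L2 f)"
    using surj by (metis surj_def surj_pair)
  then have eq: "AE x in MI. of_real g * (LINT y|MI. fun_L2 a y) + (of_real (u x) - of_real r) * fun_L2 b x
      = fun_L2 (class_L2 f) x"
    unfolding T_eq_iff by simp
  define m where "m = of_real g * (LINT y|MI. fun_L2 a y)"
  define N where "N = (LINT x|MI. (cmod (fun_L2 b x))\<^sup>2)"
  have bint: "integrable MI (\<lambda>x. (cmod (fun_L2 b x))\<^sup>2)"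
    using sqint_fun_L2[of b] by (simp add: in_Lp_def)
  \<comment> \<open>On \<open>B k\<close> the modulus of \<open>f\<close> is at most
    \<open>2^(-k)\<close> times that of \<open>b\<close>, plus that of \<open>m\<close>, while its
    square is at least \<open>e k\<close>. Squaring and integrating compares the mass
    \<open>2^(-k)\<close> with terms of order \<open>4^(-k)\<close>.\<close>
  have main: "2 ^ k \<le> 2 * N + 2 * (cmod m)\<^sup>2" for k
  proof -
    have "(1/2)^k = (LINT x|MI. e k x)" by (simp add: e_LINT)
    also have "\<dots> \<le> (LINT x|MI. 2 * (1/4)^k * (cmod (fun_L2 b x))\<^sup>2 + 2 * (cmod m)\<^sup>2 * indicator (B k) x)"
    proof (rule integral_mono_AE)
      show "integrable MI (\<lambda>x. 2 * (1/4)^k * (cmod (fun_L2 b x))\<^sup>2 + 2 * (cmod m)\<^sup>2 * indicator (B k) x)"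
        by (intro Bochner_Integration.integrable_add integrable_mult_right bint intB)
      show "AE x in MI. e k x \<le> 2 * (1/4)^k * (cmod (fun_L2 b x))\<^sup>2 + 2 * (cmod m)\<^sup>2 * indicator (B k) x"
        using eq h_ge fun_class_L2[OF f]
      proof eventually_elim
        case (elim x)
        show ?case
        proof (cases "x \<in> B k")
          case True
          have "cmod (f x) \<le> cmod (of_real (u x - r) * fun_L2 b x) + cmod m"
            using elim(1,3) norm_triangle_ineq[of m "of_real (u x - r) * fun_L2 b x"]
            by (simp add: m_def add.commute)
          also have "cmod (of_real (u x - r) * fun_L2 b x) \<le> (1/2)^k * cmod (fun_L2 b x)"
            unfolding norm_mult norm_of_real using True s(2)[of k]
            by (intro mult_right_mono) (auto simp: B_def)
          finally have "(cmod (f x))\<^sup>2 \<le> ((1/2)^k * cmod (fun_L2 b x) + cmod m)\<^sup>2"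
            by (intro power_mono) auto
          also have "\<dots> \<le> 2 * ((1/2)^k * cmod (fun_L2 b x))\<^sup>2 + 2 * (cmod m)\<^sup>2"
            using sum_squares_bound[of "(1/2)^k * cmod (fun_L2 b x)" "cmod m"]
            by (simp add: power2_sum)
          also have "((1/2)^k * cmod (fun_L2 b x))\<^sup>2 = (1/4)^k * (cmod (fun_L2 b x))\<^sup>2"
            by (simp add: power_mult_distrib power2_eq_square flip: power_mult_distrib)
          finally show ?thesis
            using True elim(2) e_nonneg[of k x] by (auto simp: cf intro: order_trans[of _ "h x"])
        next
          case False
          then show ?thesis by (simp add: e_def)
        qed
      qed
    qed (rule e_int)
    also have "\<dots> = 2 * (1/4)^k * N + 2 * (cmod m)\<^sup>2 * \<beta> k"
      using bint intB by (simp add: N_def \<beta>_def)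
    also have "\<dots> \<le> 2 * (1/4)^k * N + 2 * (cmod m)\<^sup>2 * (1/4)^k"
    proof -
      have "\<beta> k \<le> (1/4)^k"
        using \<beta>8[of k] power_mono[of "1/8" "1/4::real" k] by simp
      then show ?thesis by (intro add_left_mono mult_left_mono) auto
    qed
    finally have "4^k * (1/2)^k \<le> 4^k * ((1/4)^k * (2 * N + 2 * (cmod m)\<^sup>2))"
      by (intro mult_left_mono) (auto simp: algebra_simps)
    then show ?thesis
      by (simp add: mult.assoc[symmetric] flip: power_mult_distrib)
  qed
  obtain k where "2 * N + 2 * (cmod m)\<^sup>2 < 2 ^ k"
    using real_arch_pow[of 2] by auto
  with main[of k] show False by simp
qed

section \<open>Cutting off near a level, and density of the range\<close>

definition cut :: "real \<Rightarrow> nat \<Rightarrow> (real \<Rightarrow> complex) \<Rightarrow> real \<Rightarrow> complex" where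
  "cut r n f x = (if near r n x then 0 else f x)"

lemma cut_meas: "f \<in> borel_measurable MI \<Longrightarrow> cut r n f \<in> borel_measurable MI"
  unfolding cut_def by (intro measurable_If near_meas) simp_all

lemma sqint_cut: "sqint f \<Longrightarrow> sqint (cut r n f)"
  by (rule sqint_dominated[of f _ 1]) (auto simp: cut_meas in_Lp_def, simp add: cut_def)

text \<open>The squared error is the integral of the squared modulus of \<open>f\<close> over
  neighbourhoods of the level that shrink to a null set.\<close>

lemma cut_tendsto:
  assumes f: "sqint f" and ne: "AE x in MI. u x \<noteq> r"
  shows "(\<lambda>n. class_L2 (cut r n f)) \<longlonglongrightarrow> class_L2 f"
proof -
  let ?B = "\<lambda>n. {x \<in> space MI. near r n x}"
  have "(norm (class_L2 (cut r n f) - class_L2 f))\<^sup>2 = (LINT x|MI. indicator (?B n) x * (cmod (f x))\<^sup>2)" for n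
    unfolding class_L2_diff[OF sqint_cut[OF f] f] norm_class_L2[OF sqint_diff[OF sqint_cut[OF f] f]]
    by (rule Bochner_Integration.integral_cong) (auto simp: cut_def indicator_def)
  moreover have "(\<lambda>n. LINT x|MI. indicator (?B n) x * (cmod (f x))\<^sup>2) \<longlonglongrightarrow> 0"
  proof (rule tail_integral_tendsto_0)
    show "AE x in MI. eventually (\<lambda>n. x \<notin> ?B n) sequentially"
      using ne
    proof eventually_elim
      case (elim x)
      from eventually_not_near[OF this] show ?case by eventually_elim simp
    qed
    show "integrable MI (\<lambda>x. (cmod (f x))\<^sup>2)" using f by (simp add: in_Lp_def)
  qed (rule near_meas)
  ultimately have "(\<lambda>n. (norm (class_L2 (cut r n f) - class_L2 f))\<^sup>2) \<longlonglongrightarrow> 0" by simp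
  from tendsto_real_sqrt[OF this]
  have "(\<lambda>n. norm (class_L2 (cut r n f) - class_L2 f)) \<longlonglongrightarrow> 0" by simp
  then show ?thesis by (simp add: LIM_zero_iff tendsto_norm_zero_iff)
qed

lemma kern_real: "kern (of_real r) x = of_real (g * H x / (r - u x)\<^sup>2)"
  by (simp add: kern_def)

lemma kern_real_factored: "kern (of_real r) x = of_real (g * H x) / of_real (u x - r) / of_real (u x - r)"
  unfolding kern_real power2_commute[of r] by (simp add: power2_eq_square)

text \<open>For real \<open>r\<close> the kernel is real, so pairing it without conjugation with its
  own truncation gives a squared norm.\<close>

lemma kern_real_square: "of_real ((cmod (kern (of_real r) x))\<^sup>2) = kern (of_real r) x * kern (of_real r) x"
  unfolding kern_real norm_of_real power2_abs by (simp only: power2_eq_square of_real_mult)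

text \<open>The preimage has second component 0 and first component
  \<open>cut r n a / (u - r)\<close>; its mean contributes only a constant to the second row.
  Density thus reduces to pairs with first component 0.\<close>

lemma range_T_first:
  assumes a: "sqint a" and ne: "AE x in MI. u x \<noteq> r"
  shows "\<exists>k. (class_L2 (cut r n a), class_L2 (\<lambda>_. k)) \<in> range (T (of_real r))"
proof -
  define \<phi> where "\<phi> x = cut r n a x / of_real (u x - r)" for x
  have am [measurable]: "cut r n a \<in> borel_measurable MI" using a by (auto simp: in_Lp_def intro: cut_meas)
  have \<phi>: "sqint \<phi>"
  proof (rule sqint_dominated[OF a])
    show "\<phi> \<in> borel_measurable MI" unfolding \<phi>_def by measurable
    show "AE x in MI. cmod (\<phi> x) \<le> real (Suc n) * cmod (a x)"
      by (rule AE_I2) (auto simp: \<phi>_def cut_def not_near_bound simp del: of_real_diff of_nat_Suc)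
  qed
  have "T (of_real r) (class_L2 \<phi>, class_L2 (\<lambda>_. 0))
      = (class_L2 (cut r n a), class_L2 (\<lambda>_. of_real g * (LINT y|MI. \<phi> y)))"
  proof (rule T_class)
    show "AE x in MI. (of_real (u x) - of_real r) * \<phi> x + of_real (H x) * 0 = cut r n a x"
      using ne by eventually_elim (simp add: \<phi>_def flip: of_real_diff)
  qed (simp_all add: \<phi> a sqint_cut sqint_const)
  then show ?thesis by (metis rangeI)
qed

text \<open>With \<open>\<psi> = b / (u - r)\<close> and
  \<open>\<phi> = - H \<psi> / (u - r)\<close> the first row cancels, and \<open>g\<close> times the
  mean of \<open>\<phi>\<close> is minus the integral of \<open>kern\<close> times \<open>b\<close>.
  Since \<open>b\<close> vanishes near the level, both divisions stay in \<open>L2\<close>.\<close>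

lemma range_T_second:
  assumes b: "sqint b" and ne: "AE x in MI. u x \<noteq> r"
    and cut: "\<And>x. cut r n b x = b x"
  shows "(0, class_L2 b - scaleC (LINT x|MI. kern (of_real r) x * b x) (class_L2 (\<lambda>_. 1)))
      \<in> range (T (of_real r))"
proof -
  let ?v = "\<lambda>x. complex_of_real (u x - r)"
  define \<psi> where "\<psi> x = b x / ?v x" for x
  define \<phi> where "\<phi> x = of_real (- H x) * (\<psi> x / ?v x)" for x
  have bm [measurable]: "b \<in> borel_measurable MI" using b by (simp add: in_Lp_def)
  have b0: "b x = 0" if "near r n x" for x
    using cut[of x] that by (simp add: cut_def)
  have \<psi>: "sqint \<psi>"
  proof (rule sqint_dominated[OF b])
    show "\<psi> \<in> borel_measurable MI" unfolding \<psi>_def by measurable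
    show "AE x in MI. cmod (\<psi> x) \<le> real (Suc n) * cmod (b x)"
    proof (rule AE_I2)
      fix x
      show "cmod (\<psi> x) \<le> real (Suc n) * cmod (b x)"
        by (cases "near r n x") (simp_all add: \<psi>_def b0 not_near_bound del: of_real_diff of_nat_Suc)
    qed
  qed
  have \<psi>v: "sqint (\<lambda>x. \<psi> x / ?v x)"
  proof (rule sqint_dominated[OF \<psi>])
    have [measurable]: "\<psi> \<in> borel_measurable MI" using \<psi> by (simp add: in_Lp_def)
    show "(\<lambda>x. \<psi> x / ?v x) \<in> borel_measurable MI" by measurable
    show "AE x in MI. cmod (\<psi> x / ?v x) \<le> real (Suc n) * cmod (\<psi> x)"
    proof (rule AE_I2)
      fix x
      show "cmod (\<psi> x / ?v x) \<le> real (Suc n) * cmod (\<psi> x)"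
        by (cases "near r n x") (simp add: \<psi>_def b0, rule not_near_bound)
    qed
  qed
  have "in_Linf MI (\<lambda>x. complex_of_real (- H x))"
    using H_Linf by (auto simp: in_Linf_def)
  then have \<phi>: "sqint \<phi>" unfolding \<phi>_def by (intro sqint_mult_Linf \<psi>v)
  let ?K = "LINT x|MI. kern (of_real r) x * b x"
  have "of_real g * (LINT y|MI. \<phi> y) = (LINT y|MI. of_real g * \<phi> y)" by simp
  also have "\<dots> = (LINT y|MI. - (kern (of_real r) y * b y))"
    by (rule Bochner_Integration.integral_cong)
      (simp_all add: \<phi>_def \<psi>_def kern_real_factored del: of_real_diff)
  also have "\<dots> = - ?K" by simp
  finally have K: "of_real g * (LINT y|MI. \<phi> y) = - ?K" .
  have "T (of_real r) (class_L2 \<phi>, class_L2 \<psi>) = (class_L2 (\<lambda>_. 0), class_L2 (\<lambda>x. b x - ?K * 1))"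
  proof (rule T_class)
    show "AE x in MI. (of_real (u x) - of_real r) * \<phi> x + of_real (H x) * \<psi> x = 0"
      using ne by eventually_elim (simp add: \<phi>_def flip: of_real_diff)
    show "AE x in MI. of_real g * (LINT y|MI. \<phi> y) + (of_real (u x) - of_real r) * \<psi> x = b x - ?K * 1"
      unfolding K using ne by eventually_elim (simp add: \<psi>_def flip: of_real_diff)
  qed (use \<phi> \<psi> b in \<open>auto intro: sqint_diff sqint_const\<close>)
  moreover have "class_L2 (\<lambda>x. b x - ?K * 1) = class_L2 b - scaleC ?K (class_L2 (\<lambda>_. 1))"
    unfolding class_L2_scaleC[OF sqint_const] by (rule class_L2_diff[symmetric]) (simp_all add: b sqint_const)
  ultimately show ?thesis
    unfolding zero_L2_def by (metis rangeI)
qed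

text \<open>The functional in \<open>range_T_second\<close> is continuous on \<open>L2\<close> when
  the kernel is square integrable. Then \<open>b\<close> is solved for and truncated; otherwise
  truncations of the kernel correct an approximation of \<open>y\<close> at arbitrarily small
  cost.\<close>

lemma second_component_closure:
  assumes ne: "AE x in MI. u x \<noteq> r"
    and inj: "of_real r \<notin> point_spectrum (A0 g u H)"
  shows "(0, y) \<in> closure (range (T (of_real r)))"
proof (cases "sqint (kern (of_real r))")
  case True
  let ?k = "kern (of_real r)" and ?D = "dispersion_integral g u H (of_real r)"
  let ?e = "class_L2 (\<lambda>_. 1)"
  have D: "?D \<noteq> 1"
    using point_spectrum_iff_sqint[of "of_real r"] ne inj True by simp
  \<comment> \<open>For \<open>b = y + t\<close> the functional takes the value
    \<open>integral_L2 ?k y + t * ?D\<close>. Requiring it to equal \<open>t\<close> yields this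
    quotient, and \<open>b\<close> minus its own functional is then \<open>y\<close>.\<close>
  define t where "t = integral_L2 ?k y / (1 - ?D)"
  define b where "b x = fun_L2 y x + t * 1" for x
  have b: "sqint b" unfolding b_def by (intro sqint_add sqint_const sqint_fun_L2 sqint_cmult)
  have cb: "class_L2 b = y + scaleC t ?e"
    unfolding b_def class_L2_scaleC[OF sqint_const]
    by (subst class_L2_add[symmetric]) (simp_all add: sqint_fun_L2 sqint_const class_fun_L2)
  have "integral_L2 ?k ?e = ?D"
    by (simp add: integral_L2_class True sqint_const dispersion_integral_eq)
  then have "integral_L2 ?k (class_L2 b) = integral_L2 ?k y + t * ?D"
    unfolding cb using linear_add[OF bounded_linear.linear[OF bounded_linear_integral_L2[OF True]]]
    by (simp add: integral_L2_scaleC[OF True])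
  also have "\<dots> = t" using D by (simp add: t_def field_simps)
  finally have Lb: "integral_L2 ?k (class_L2 b) = t" .
  let ?z = "\<lambda>n. (0, class_L2 (cut r n b) - scaleC (integral_L2 ?k (class_L2 (cut r n b))) ?e)"
  have in_range: "?z n \<in> range (T (of_real r))" for n
    unfolding integral_L2_class[OF True sqint_cut[OF b]]
    by (rule range_T_second[OF sqint_cut[OF b] ne, where n = n]) (simp add: cut_def split: if_splits)
  have "?z \<longlonglongrightarrow> (0, class_L2 b - scaleC (integral_L2 ?k (class_L2 b)) ?e)"
    by (intro tendsto_Pair tendsto_const tendsto_diff cut_tendsto[OF b ne]
        bounded_linear.tendsto[OF bounded_linear_scaleC_left]
        bounded_linear.tendsto[OF bounded_linear_integral_L2[OF True]])
  moreover have "class_L2 b - scaleC (integral_L2 ?k (class_L2 b)) ?e = y"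
    unfolding Lb by (simp add: cb)
  ultimately show ?thesis
    using in_range unfolding closure_sequential by fastforce
next
  case False
  let ?k = "kern (of_real r)"
  define d where "d n = cut r n ?k" for n
  define N where "N n = (LINT x|MI. (cmod (d n x))\<^sup>2)" for n
  obtain C where C: "AE x in MI. \<bar>H x\<bar> \<le> C" by (rule H_upper)
  have d: "sqint (d n)" for n
  proof (rule sqint_bounded)
    show "d n \<in> borel_measurable MI" unfolding d_def by (rule cut_meas) measurable
    show "AE x in MI. cmod (d n x) \<le> real (Suc n) * (real (Suc n) * (g * C))"
      using C
    proof eventually_elim
      case (elim x)
      show ?case
      proof (cases "near r n x")
        case True
        then show ?thesis using elim g_pos by (simp add: d_def cut_def)
      next
        case False
        have "cmod (d n x) = cmod (of_real (g * H x) / of_real (u x - r) / of_real (u x - r))"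
          using False by (simp only: d_def cut_def kern_real_factored if_False)
        also have "\<dots> \<le> real (Suc n) * (real (Suc n) * cmod (of_real (g * H x)))"
          by (intro order_trans[OF not_near_bound[OF False]] mult_left_mono not_near_bound[OF False] of_nat_0_le_iff)
        also have "\<dots> \<le> real (Suc n) * (real (Suc n) * (g * C))"
          using elim g_pos by (intro mult_left_mono) (auto simp: norm_mult)
        finally show ?thesis .
      qed
    qed
  qed
  have dint: "integrable MI (\<lambda>x. (cmod (d n x))\<^sup>2)" for n
    using d[of n] by (simp add: in_Lp_def)
  \<comment> \<open>The truncated kernels increase in modulus to the kernel a.e. If their norms
    stayed bounded, monotone convergence would make the kernel square integrable.\<close>
  have unbounded: "\<exists>n. K < N n" for K
  proof (rule ccontr)
    assume "\<not> ?thesis"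
    then have le: "N n \<le> K" for n by (simp add: not_less)
    have mono: "(cmod (d n x))\<^sup>2 \<le> (cmod (d k x))\<^sup>2" if "n \<le> k" for n k x
    proof -
      have "near r k x \<Longrightarrow> near r n x" using near_mono[OF that] .
      then show ?thesis by (auto simp: d_def cut_def)
    qed
    have inc: "incseq N"
      unfolding N_def by (intro incseq_SucI integral_mono dint mono) simp
    then obtain L where L: "N \<longlonglongrightarrow> L"
      using incseq_convergent[OF inc, of K] le by blast
    have "integrable MI (\<lambda>x. (cmod (?k x))\<^sup>2)"
    proof (rule integrable_monotone_convergence[where f = "\<lambda>n x. (cmod (d n x))\<^sup>2" and x = L])
      show "AE x in MI. mono (\<lambda>n. (cmod (d n x))\<^sup>2)"
        by (intro AE_I2 monoI mono)
      show "AE x in MI. (\<lambda>n. (cmod (d n x))\<^sup>2) \<longlonglongrightarrow> (cmod (?k x))\<^sup>2"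
        using ne
      proof eventually_elim
        case (elim x)
        from eventually_not_near[OF this]
        have "eventually (\<lambda>n. (cmod (d n x))\<^sup>2 = (cmod (?k x))\<^sup>2) sequentially"
          by eventually_elim (simp add: d_def cut_def)
        then show ?case by (rule tendsto_eventually)
      qed
      show "(\<lambda>n. LINT x|MI. (cmod (d n x))\<^sup>2) \<longlonglongrightarrow> L" using L by (simp add: N_def[abs_def])
    qed (use dint in simp_all)
    then have "sqint ?k" by (simp add: in_Lp_def)
    with False show False ..
  qed
  show ?thesis
    unfolding closure_approachable
  proof (intro allI impI)
    fix \<epsilon> :: real
    assume \<epsilon>: "\<epsilon> > 0"
    have "(\<lambda>n. class_L2 (cut r n (fun_L2 y))) \<longlonglongrightarrow> y"
      using cut_tendsto[OF sqint_fun_L2 ne, of y] by (simp add: class_fun_L2)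
    then obtain n where n: "dist (class_L2 (cut r n (fun_L2 y))) y < \<epsilon> / 2"
      using \<epsilon> by (meson LIMSEQ_iff_nz half_gt_zero metric_LIMSEQ_D order_refl)
    define f where "f = cut r n (fun_L2 y)"
    have f: "sqint f" unfolding f_def by (rule sqint_cut[OF sqint_fun_L2])
    define K where "K = (LINT x|MI. ?k x * f x)"
    \<comment> \<open>The correction below has norm \<open>cmod K / sqrt (N k)\<close>, which this
      choice makes smaller than half of \<open>\<epsilon>\<close>.\<close>
    obtain k where k: "(cmod K / (\<epsilon> / 2))\<^sup>2 < N k" using unbounded by blast
    then have Nk: "N k > 0" using zero_le_power2 by (rule le_less_trans[rotated])
    \<comment> \<open>\<open>d k\<close> has norm \<open>\<surd>N k\<close> and \<open>\<ell>(d k) = N k\<close>, so a small multiple of it annihilates \<open>\<ell>(f)\<close>.\<close>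
    define b where "b x = f x - K / of_real (N k) * d k x" for x
    have b: "sqint b" unfolding b_def by (intro sqint_diff sqint_cmult f d)
    have cb: "class_L2 b = class_L2 f - scaleC (K / of_real (N k)) (class_L2 (d k))"
      unfolding b_def class_L2_scaleC[OF d] by (rule class_L2_diff[OF f sqint_cmult[OF d], symmetric])
    \<comment> \<open>\<open>f\<close> and \<open>d k\<close> are cut at different radii; the index
      \<open>max n k\<close> gives the smaller one, within which both vanish.\<close>
    have bcut: "cut r (max n k) b x = b x" for x
    proof -
      have "near r (max n k) x \<Longrightarrow> near r n x" "near r (max n k) x \<Longrightarrow> near r k x"
        by (erule near_mono[rotated], simp)+
      then show ?thesis by (auto simp: cut_def b_def f_def d_def)
    qed
    have dk: "of_real ((cmod (d k x))\<^sup>2) = ?k x * d k x" for x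
      using kern_real_square[of r x] by (cases "near r k x") (simp_all add: d_def cut_def del: of_real_power)
    have kf: "?k x * b x = ?k x * f x - K / of_real (N k) * of_real ((cmod (d k x))\<^sup>2)" for x
      unfolding dk b_def by (simp add: algebra_simps)
    \<comment> \<open>The kernel itself is not square integrable here, but on the support of
      \<open>f\<close> it coincides with its truncation \<open>d n\<close>.\<close>
    have kfint: "integrable MI (\<lambda>x. ?k x * f x)"
    proof -
      have "(\<lambda>x. ?k x * f x) = (\<lambda>x. d n x * f x)" by (simp add: fun_eq_iff d_def f_def cut_def)
      then show ?thesis using integrable_mult_sqint[OF d f] by (simp only:)
    qed
    have "(LINT x|MI. ?k x * b x) = K - K / of_real (N k) * of_real (N k)"
      unfolding kf using kfint dint
      by (subst Bochner_Integration.integral_diff) (auto simp: K_def N_def simp del: of_real_power)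
    also have "\<dots> = 0" using Nk by simp
    finally have "(0, class_L2 b) \<in> range (T (of_real r))"
      using range_T_second[OF b ne bcut] by (simp add: scaleC_zero_left)
    moreover have "dist (0 :: L2, class_L2 b) (0, y) < \<epsilon>"
    proof -
      have "norm (class_L2 (d k)) = sqrt (N k)"
        using norm_class_L2[OF d[of k]] by (metis N_def norm_ge_zero real_sqrt_unique)
      then have "dist (class_L2 b) (class_L2 f) = cmod K / N k * sqrt (N k)"
        unfolding cb using Nk by (simp add: dist_norm norm_scaleC norm_divide)
      also have "\<dots> = cmod K / sqrt (N k)"
        using Nk real_sqrt_mult_self[of "N k"] by (simp add: field_simps)
      also have "\<dots> < \<epsilon> / 2"
      proof -
        have "cmod K / (\<epsilon> / 2) < sqrt (N k)" using k by (intro real_less_rsqrt) simp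
        then show ?thesis using \<epsilon> Nk by (simp add: field_simps)
      qed
      finally have "dist (class_L2 b) y < \<epsilon>"
        using n dist_triangle_half_r[of "class_L2 f" "class_L2 b" \<epsilon> y]
        by (simp add: dist_commute f_def)
      then show ?thesis by (simp add: dist_Pair_Pair)
    qed
    ultimately show "\<exists>z\<in>range (T (of_real r)). dist z (0, y) < \<epsilon>" by blast
  qed
qed

text \<open>A cut-off first component is attained together with some constant second component.
  Adding a limit of pairs with first component 0 corrects the second one, and the closure is stable
  under this because the range is a subspace.\<close>

lemma dense_range_T:
  assumes ne: "AE x in MI. u x \<noteq> r"
    and inj: "of_real r \<notin> point_spectrum (A0 g u H)"
  shows "closure (range (T (of_real r))) = UNIV"
proof -
  let ?R = "range (T (of_real r))"
  have "subspace ?R"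
    using linear_subspace_image[OF bounded_linear.linear[OF bounded_linear_T] subspace_UNIV] .
  then have RR: "?R + ?R \<subseteq> ?R"
    by (auto simp: set_plus_def subspace_add)
  have add: "p + q \<in> closure ?R" if "p \<in> ?R" "q \<in> closure ?R" for p q
  proof -
    have "p + q \<in> closure ?R + closure ?R"
      using that closure_subset[of ?R] by (intro set_plus_intro) blast+
    also have "\<dots> \<subseteq> closure ?R"
      using closure_sum closure_mono[OF RR] by blast
    finally show ?thesis .
  qed
  have "(x, y) \<in> closure ?R" for x y
  proof -
    have "(class_L2 (cut r n (fun_L2 x)), y) \<in> closure ?R" for n
    proof -
      obtain k where k: "(class_L2 (cut r n (fun_L2 x)), class_L2 (\<lambda>_. k)) \<in> ?R"
        using range_T_first[OF sqint_fun_L2 ne] by blast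
      from add[OF this second_component_closure[OF ne inj, of "y - class_L2 (\<lambda>_. k)"]]
      show ?thesis by simp
    qed
    moreover have "(\<lambda>n. (class_L2 (cut r n (fun_L2 x)), y)) \<longlonglongrightarrow> (x, y)"
      using cut_tendsto[OF sqint_fun_L2 ne, of x] by (intro tendsto_Pair tendsto_const) (simp add: class_fun_L2)
    ultimately show ?thesis
      by (rule closed_sequentially[OF closed_closure])
  qed
  then show ?thesis by auto
qed

section \<open>Continuous profiles\<close>

text \<open>A value off the compact image has positive distance from it. Conversely, by continuity
  \<open>u\<close> stays close to an attained value on a relative neighbourhood, which has positive
  measure even at an endpoint.\<close>

lemma ess_range_continuous:
  assumes cont: "continuous_on {0..1} u"
  shows "ess_range u = u ` {0..1}"
proof (rule set_eqI)
  fix c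
  show "c \<in> ess_range u \<longleftrightarrow> c \<in> u ` {0..1}"
  proof
    assume c: "c \<in> ess_range u"
    show "c \<in> u ` {0..1}"
    proof (rule ccontr)
      assume "c \<notin> u ` {0..1}"
      moreover have "closed (u ` {0..1})"
        by (intro compact_imp_closed compact_continuous_image cont) simp
      ultimately obtain e where e: "e > 0" "\<forall>y\<in>u ` {0..1}. e \<le> dist c y"
        using separate_point_closed by metis
      have "AE x in MI. e \<le> \<bar>u x - c\<bar>"
        by (rule AE_I2) (use e(2) in \<open>auto simp: dist_real_def abs_minus_commute\<close>)
      with c e(1) show False by (auto simp: ess_range_iff)
    qed
  next
    assume "c \<in> u ` {0..1}"
    then obtain x0 where x0: "x0 \<in> {0..1}" "c = u x0" by auto
    show "c \<in> ess_range u"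
      unfolding ess_range_iff
    proof (intro allI impI notI)
      fix \<epsilon> :: real assume \<epsilon>: "\<epsilon> > 0" and AE: "AE x in MI. \<epsilon> \<le> \<bar>u x - c\<bar>"
      obtain d where d: "d > 0" "\<And>x. x \<in> {0..1} \<Longrightarrow> dist x x0 < d \<Longrightarrow> dist (u x) (u x0) < \<epsilon>"
        using cont x0(1) \<epsilon> unfolding continuous_on_iff by metis
      let ?B = "{x \<in> I01. \<bar>x - x0\<bar> < min d 1}"
      have "AE x in MI. indicator ?B x = (0::real)"
        using AE
      proof eventually_elim
        case (elim x)
        show ?case
          using elim d(2)[of x] x0(2) by (auto simp: indicator_def dist_real_def)
      qed
      then have "(LINT x|MI. indicator ?B x) = (LINT x|MI. (0::real))"
        by (intro integral_cong_AE borel_measurable_indicator MI_near_sets) auto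
      moreover have "min d 1 \<le> (LINT x|MI. indicator ?B x)"
        using x0(1) d(1) by (intro LINT_indicator_near) auto
      ultimately show False using d(1) by simp
    qed
  qed
qed

text \<open>Divergence is shown on intervals shrinking to \<open>x0\<close>: integrability of
  \<open>F\<close> would force the integrals over \<open>B n\<close> to 0, yet they stay above a
  fixed positive number.\<close>

lemma holder_not_inverse_in_L4:
  assumes "holder_on (1/4) {0..1} u" "x0 \<in> {0..1}"
  shows "\<not> inverse_in_Lp 4 MI (\<lambda>x. complex_of_real (u x0) - complex_of_real (u x))"
proof
  assume inv: "inverse_in_Lp 4 MI (\<lambda>x. complex_of_real (u x0) - complex_of_real (u x))"
  interpret finite_measure MI by (rule finite_measure_MI)
  define F where "F x = cmod (inverse (complex_of_real (u x0) - complex_of_real (u x))) ^ 4" for x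
  have ne: "AE x in MI. u x \<noteq> u x0" and F: "integrable MI F"
    using inv by (auto simp: inverse_in_Lp_def in_Lp_def F_def[abs_def] elim: eventually_mono)
  obtain C0 where C0: "\<And>x. x \<in> {0..1} \<Longrightarrow> \<bar>u x0 - u x\<bar> \<le> C0 * \<bar>x0 - x\<bar> powr (1/4)"
    using assms unfolding holder_on_def by blast
  \<comment> \<open>A constant of at least 1 can be used as a divisor.\<close>
  define C where "C = max C0 1"
  have C: "\<bar>u x0 - u x\<bar> \<le> C * \<bar>x0 - x\<bar> powr (1/4)" if "x \<in> {0..1}" for x
    by (rule order_trans[OF C0[OF that]]) (auto simp: C_def intro: mult_right_mono)
  have C1: "C \<ge> 1" by (simp add: C_def)
  have C4: "\<bar>u x0 - u x\<bar> ^ 4 \<le> C ^ 4 * \<bar>x - x0\<bar>" if "x \<in> {0..1}" for x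
  proof -
    have "\<bar>u x0 - u x\<bar> ^ 4 \<le> (C * \<bar>x0 - x\<bar> powr (1/4)) ^ 4"
      by (intro power_mono C that) simp
    also have "\<dots> = C ^ 4 * \<bar>x - x0\<bar>"
      by (cases "x = x0") (simp_all add: power_mult_distrib abs_minus_commute powr_power)
    finally show ?thesis .
  qed
  define B where "B n = {x \<in> I01. \<bar>x - x0\<bar> < 1 / real (Suc n)}" for n
  have B [measurable]: "B n \<in> sets MI" for n unfolding B_def by (rule MI_near_sets)
  have "(\<lambda>n. LINT x|MI. indicator (B n) x * F x) \<longlonglongrightarrow> 0"
  proof (rule tail_integral_tendsto_0[OF F B])
    show "AE x in MI. eventually (\<lambda>n. x \<notin> B n) sequentially"
      using AE_MI_neq[of x0]
    proof eventually_elim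
      case (elim x)
      then have "eventually (\<lambda>n. 1 / real (Suc n) < \<bar>x - x0\<bar>) sequentially"
        by (intro order_tendstoD[OF lim_1_over_n[THEN LIMSEQ_Suc]]) auto
      then show ?case by eventually_elim (simp add: B_def)
    qed
  qed
  \<comment> \<open>On \<open>B n\<close> the integrand is at least \<open>(n + 1) / C ^ 4\<close>,
    and \<open>B n\<close> has measure at least \<open>1 / (n + 1)\<close>.\<close>
  moreover have "1 / C ^ 4 \<le> (LINT x|MI. indicator (B n) x * F x)" for n
  proof -
    have "1 / C ^ 4 = (real (Suc n) / C ^ 4) * (1 / real (Suc n))" by simp
    also have "\<dots> \<le> (real (Suc n) / C ^ 4) * (LINT x|MI. indicator (B n) x)"
      unfolding B_def using assms(2) C1
      by (intro mult_left_mono LINT_indicator_near) auto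
    also have "\<dots> = (LINT x|MI. real (Suc n) / C ^ 4 * indicator (B n) x)" by simp
    also have "\<dots> \<le> (LINT x|MI. indicator (B n) x * F x)"
    proof (rule integral_mono_AE)
      show "integrable MI (\<lambda>x. real (Suc n) / C ^ 4 * indicator (B n) x)"
        by (intro integrable_mult_right integrable_const_bound[of _ 1]) (auto simp: indicator_def)
      show "integrable MI (\<lambda>x. indicator (B n) x * F x)"
        using integrable_mult_indicator[OF B F, of n] by simp
      show "AE x in MI. real (Suc n) / C ^ 4 * indicator (B n) x \<le> indicator (B n) x * F x"
        using ne
      proof eventually_elim
        case (elim x)
        show ?case
        proof (cases "x \<in> B n")
          case True
          then have x: "x \<in> {0..1}" "\<bar>x - x0\<bar> < 1 / real (Suc n)" by (auto simp: B_def)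
          have "\<bar>u x0 - u x\<bar> ^ 4 \<le> C ^ 4 * (1 / real (Suc n))"
            by (rule order_trans[OF C4[OF x(1)]], rule mult_left_mono) (use x(2) C1 in auto)
          moreover have "0 < \<bar>u x0 - u x\<bar> ^ 4" using elim by simp
          ultimately have "1 / (C ^ 4 * (1 / real (Suc n))) \<le> 1 / \<bar>u x0 - u x\<bar> ^ 4"
            by (intro divide_left_mono mult_pos_pos) (use C1 in auto)
          also have "\<dots> = F x"
            by (simp only: F_def norm_inverse norm_of_real power_inverse divide_inverse mult_1_left
                flip: of_real_diff)
          finally show ?thesis using True by simp
        qed simp
      qed
    qed
    finally show ?thesis .
  qed
  ultimately have "1 / C ^ 4 \<le> 0"
    by (intro LIMSEQ_le_const) auto
  with C1 show False by (simp add: divide_le_0_iff)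
qed

section \<open>Assembly of the spectra\<close>

lemma of_real_AE: "(AE x in MI. complex_of_real (u x) \<noteq> of_real r) \<longleftrightarrow> (AE x in MI. u x \<noteq> r)"
  by simp

text \<open>The two sets correspond to \<open>u\<close> differing from \<open>c\<close> a.e. or not;
  in the second case \<open>c\<close> is automatically real and in the essential range.\<close>

lemma point_spectrum_eq:
  "point_spectrum (A0 g u H) =
    {c. inverse_in_Lp 4 MI (\<lambda>x. c - complex_of_real (u x)) \<and> dispersion_integral g u H c = 1} \<union>
    complex_of_real ` {c \<in> ess_range u. emeasure MI {x \<in> I01. u x = c} > 0}" (is "_ = ?A \<union> ?B")
proof (rule set_eqI)
  fix c
  show "c \<in> point_spectrum (A0 g u H) \<longleftrightarrow> c \<in> ?A \<union> ?B"
  proof (cases "AE x in MI. of_real (u x) \<noteq> c")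
    case True
    then have "c \<notin> ?B" unfolding level_set_iff by auto
    with True show ?thesis
      using point_spectrum_iff_sqint[OF True] by (simp add: inverse_in_L4_iff_kern)
  next
    case False
    have "c \<in> complex_of_real ` ess_range u"
      using False not_ess_range_AE(1) by blast
    then have "c \<in> ?B" using False unfolding level_set_iff by auto
    with False show ?thesis using point_spectrum_level_set by blast
  qed
qed

text \<open>Here \<open>1 / (c - u)\<close> is essentially bounded, so the \<open>L^4\<close>
  condition is automatic and the dispersion relation alone decides.\<close>

lemma outside_ess_range:
  assumes "c \<notin> complex_of_real ` ess_range u"
  shows "c \<in> point_spectrum (A0 g u H) \<longleftrightarrow> dispersion_integral g u H c = 1"
    and "inverse_in_Lp 4 MI (\<lambda>x. c - complex_of_real (u x))"
  using point_spectrum_iff_sqint[OF not_ess_range_AE(1)] not_ess_range_AE[OF assms] assms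
  by (auto simp: inverse_in_L4_iff_kern)

text \<open>Not being an eigenvalue forces the level set to be null, so the range is dense but not
  everything.\<close>

lemma inside_ess_range:
  assumes "c \<in> complex_of_real ` ess_range u" "c \<notin> point_spectrum (A0 g u H)"
  shows "c \<in> continuous_spectrum (A0 g u H)"
proof -
  obtain r where r: "c = of_real r" "r \<in> ess_range u" using assms(1) by auto
  have ne: "AE x in MI. u x \<noteq> r"
    using assms(2) point_spectrum_level_set[of c] unfolding r(1) of_real_AE by blast
  show ?thesis
    using dense_range_T[OF ne] not_surj_T[OF r(2) ne] assms(2)
    by (simp add: continuous_spectrum_def point_spectrum_def r(1))
qed

end

theorem theorem4p1:
  fixes g :: real and u H :: "real \<Rightarrow> real"
  assumes "g > 0"
    and "in_Linf MI u" and "in_Linf MI H"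
    and "essinf MI H > 0"
  shows
    "op_spectrum (A0 g u H) =
       complex_of_real ` ess_range u \<union>
       {c. c \<notin> complex_of_real ` ess_range u \<and> dispersion_integral g u H c = 1}
     \<and> point_spectrum (A0 g u H) =
       {c. inverse_in_Lp 4 MI (\<lambda>x. c - complex_of_real (u x)) \<and> dispersion_integral g u H c = 1} \<union>
       complex_of_real ` {c \<in> ess_range u. emeasure MI {x \<in> I01. u x = c} > 0}
     \<and> continuous_spectrum (A0 g u H) =
       complex_of_real ` ess_range u - point_spectrum (A0 g u H)
     \<and> residual_spectrum (A0 g u H) = {}
     \<and> (holder_on (1/4) {0..1} u \<longrightarrow>
         ess_range u = u ` {0..1}
       \<and> (\<forall>c \<in> u ` {0..1}.
            \<not> inverse_in_Lp 4 MI (\<lambda>x. complex_of_real c - complex_of_real (u x)))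
       \<and> point_spectrum (A0 g u H) =
         {c. c \<notin> complex_of_real ` u ` {0..1} \<and> dispersion_integral g u H c = 1} \<union>
         complex_of_real ` {c \<in> u ` {0..1}. emeasure MI {x \<in> I01. u x = c} > 0}
       \<and> continuous_spectrum (A0 g u H) =
         complex_of_real ` {c \<in> u ` {0..1}. emeasure MI {x \<in> I01. u x = c} = 0}
       \<and> residual_spectrum (A0 g u H) = {})"
proof -
  interpret shear_flow g u H by unfold_locales (fact assms)+
  let ?A = "A0 g u H" and ?D = "dispersion_integral g u H" and ?E = "complex_of_real ` ess_range u"
  have invertible: "inj (T c) \<and> range (T c) = UNIV \<and> c \<notin> op_spectrum ?A"
    if "c \<notin> ?E" "?D c \<noteq> 1" for c
    using invertible_T[OF that] invertible_op_bij by (auto simp: op_spectrum_def)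
  have op: "c \<in> op_spectrum ?A" if "c \<in> point_spectrum ?A \<or> c \<in> continuous_spectrum ?A" for c
    using that invertible_op_bij
    by (auto simp: op_spectrum_def point_spectrum_def continuous_spectrum_def)
  have disjoint: "c \<notin> continuous_spectrum ?A \<and> c \<notin> residual_spectrum ?A" if "c \<in> point_spectrum ?A" for c
    using that by (simp add: point_spectrum_def continuous_spectrum_def residual_spectrum_def)
  have characterization: "c \<in> op_spectrum ?A \<longleftrightarrow> c \<in> ?E \<or> ?D c = 1"
    "c \<in> continuous_spectrum ?A \<longleftrightarrow> c \<in> ?E \<and> c \<notin> point_spectrum ?A"
    "c \<notin> residual_spectrum ?A" for c
  proof -
    \<comment> \<open>In the second case the range is dense, and in the third the operator is
      invertible; an eigenvalue is excluded from the residual spectrum by definition. This leaves no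
      residual spectrum.\<close>
    consider "c \<in> point_spectrum ?A" | "c \<in> ?E" "c \<notin> point_spectrum ?A"
      | "c \<notin> ?E" "c \<notin> point_spectrum ?A" by blast
    then have "(c \<in> op_spectrum ?A \<longleftrightarrow> c \<in> ?E \<or> ?D c = 1)
      \<and> (c \<in> continuous_spectrum ?A \<longleftrightarrow> c \<in> ?E \<and> c \<notin> point_spectrum ?A)
      \<and> c \<notin> residual_spectrum ?A"
    proof cases
      case 1
      then show ?thesis using op[of c] disjoint[of c] outside_ess_range(1)[of c] by blast
    next
      case 2
      have *: "c \<in> continuous_spectrum ?A" using 2 by (rule inside_ess_range)
      moreover from * have "c \<notin> residual_spectrum ?A"
        by (simp add: continuous_spectrum_def residual_spectrum_def)
      ultimately show ?thesis using 2 op[of c] by blast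
    next
      case 3
      then have "?D c \<noteq> 1" using outside_ess_range(1)[of c] by blast
      with 3 show ?thesis using invertible[of c]
        by (simp add: continuous_spectrum_def residual_spectrum_def)
    qed
    then show "c \<in> op_spectrum ?A \<longleftrightarrow> c \<in> ?E \<or> ?D c = 1"
      "c \<in> continuous_spectrum ?A \<longleftrightarrow> c \<in> ?E \<and> c \<notin> point_spectrum ?A"
      "c \<notin> residual_spectrum ?A" by blast+
  qed
  have continuous: "continuous_spectrum ?A = ?E - point_spectrum ?A"
    and residual: "residual_spectrum ?A = {}"
    using characterization by blast+
  have holder: "ess_range u = u ` {0..1}
       \<and> (\<forall>c \<in> u ` {0..1}.
            \<not> inverse_in_Lp 4 MI (\<lambda>x. complex_of_real c - complex_of_real (u x)))
       \<and> point_spectrum (A0 g u H) =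
         {c. c \<notin> complex_of_real ` u ` {0..1} \<and> dispersion_integral g u H c = 1} \<union>
         complex_of_real ` {c \<in> u ` {0..1}. emeasure MI {x \<in> I01. u x = c} > 0}
       \<and> continuous_spectrum (A0 g u H) =
         complex_of_real ` {c \<in> u ` {0..1}. emeasure MI {x \<in> I01. u x = c} = 0}"
    if h: "holder_on (1/4) {0..1} u"
  proof -
    have E: "ess_range u = u ` {0..1}"
      by (rule ess_range_continuous[OF holder_on_imp_continuous_on[OF h]]) simp
    have not_L4: "\<forall>c \<in> u ` {0..1}.
        \<not> inverse_in_Lp 4 MI (\<lambda>x. complex_of_real c - complex_of_real (u x))"
      using holder_not_inverse_in_L4[OF h] by blast
    \<comment> \<open>The \<open>L^4\<close> condition fails at every point of the image and holds
      everywhere off it, so it only records where \<open>c\<close> lies.\<close>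
    have "inverse_in_Lp 4 MI (\<lambda>x. c - complex_of_real (u x)) \<longleftrightarrow> c \<notin> ?E" for c
      using outside_ess_range(2)[of c] not_L4 unfolding E by blast
    then have P: "point_spectrum ?A =
         {c. c \<notin> complex_of_real ` u ` {0..1} \<and> ?D c = 1} \<union>
         complex_of_real ` {c \<in> u ` {0..1}. emeasure MI {x \<in> I01. u x = c} > 0}"
      unfolding point_spectrum_eq E by simp
    have "continuous_spectrum ?A =
         complex_of_real ` {c \<in> u ` {0..1}. emeasure MI {x \<in> I01. u x = c} = 0}"
      unfolding continuous P E by (auto simp: zero_less_iff_neq_zero)
    with E not_L4 P show ?thesis by blast
  qed
  have "op_spectrum ?A = ?E \<union> {c. c \<notin> ?E \<and> ?D c = 1}"
    using characterization(1) by blast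
  with point_spectrum_eq continuous residual holder show ?thesis by blast
qed

end
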